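(* Let $d\ge2$, $\alpha>1$, and let $\{X_{\mathbf k},\mathbf k\in\mathbb Z_+^d\}$ be independent, identically distributed random variables (distributed as $X$) in a sub-linear expectation space with $\mathbb E(X)=\mathbb E(-X)=0$, and partial sums $S_{\mathbf n}=\sum_{\mathbf k\le\mathbf n}X_{\mathbf k}$. If $$C_{\mathbb V}\Big\{\exp\big\{(\log^+|X|)^\alpha\big\}(\log^+|X|)^{d-1}\Big\}<\infty,$$ then $$\sum_{\mathbf n\in\mathbb Z_+^d}\exp\{(\log|\mathbf n|)^\alpha\}\frac{(\log|\mathbf n|)^{\alpha-1}}{|\mathbf n|^2}\,\mathbb V(|S_{\mathbf n}|>|\mathbf n|\varepsilon)<\infty\quad\text{for all }\varepsilon>1.$$
   Context: Setting: a regular, countably sub-additive sub-linear expectation space $(\Omega,\mathcal H,\mathbb E)$ ($\mathbb E$ monotone, constant-preserving, positively homogeneous, sub-additive on a class $\mathcal H$ closed under locally Lipschitz functions), represented as $\mathbb E(X)=\sup_{P\in\mathcal P}E_P(X)$; capacity $\mathbb V(A)=\sup_{P\in\mathcal P}P(A)$; Choquet integral $C_{\mathbb V}(X)=\int_0^\infty\mathbb V(X>x)dx+\int_{-\infty}^0(\mathbb V(X>x)-1)dx$. Independence in the sub-linear sense: $Y$ is independent of $(X_1,\dots,X_m)$ if $\mathbb E[\psi(X,Y)]=\mathbb E[\mathbb E[\psi(x,Y)]|_{x=X}]$ for all locally Lipschitz $\psi$, applied along an enumeration of the index set; identically distributed means $\mathbb E[\psi(X_{\mathbf k})]=\mathbb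 E[\psi(X)]$ for locally Lipschitz $\psi$. $\mathbb Z_+^d$ is the positive integer lattice with coordinatewise order: $\mathbf m\le\mathbf n$ iff $m_k\le n_k$ for all $k$; $|\mathbf n|=\prod_{k=1}^dn_k$. $\log$ denotes $\log^+=\max(\log,0)$. *)

theory Defs
  imports "HOL-Probability.Probability"
begin

definition logp :: "real \<Rightarrow> real" where
  "logp x = (if x \<le> 1 then 0 else ln x)"

text \<open>Points of R^n are represented as functions nat => real, only the
  coordinates 0..n-1 being relevant.\<close>

definition rv_vec :: "('a \<Rightarrow> real) list \<Rightarrow> 'a \<Rightarrow> nat \<Rightarrow> real" where
  "rv_vec Xs \<omega> = (\<lambda>i. if i < length Xs then (Xs ! i) \<omega> else 0)"

definition lLip :: "nat \<Rightarrow> ((nat \<Rightarrow> real) \<Rightarrow> real) \<Rightarrow> bool" where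
  "lLip n \<phi> \<longleftrightarrow>
     (\<forall>x y. (\<forall>i<n. x i = y i) \<longrightarrow> \<phi> x = \<phi> y) \<and>
     (\<exists>C m. C > 0 \<and> (\<forall>x y. \<bar>\<phi> x - \<phi> y\<bar> \<le>
        C * (1 + (\<Sum>i<n. \<bar>x i\<bar>) ^ m + (\<Sum>i<n. \<bar>y i\<bar>) ^ m) * (\<Sum>i<n. \<bar>x i - y i\<bar>)))"

text \<open>M fixes the sample space Omega = space M and the sigma-algebra; Ps is the
  family of probability measures representing E; H is the space of random
  variables; E is the sub-linear expectation.\<close>

definition sublinear_space ::
  "'a measure \<Rightarrow> 'a measure set \<Rightarrow> ('a \<Rightarrow> real) set \<Rightarrow> (('a \<Rightarrow> real) \<Rightarrow> real) \<Rightarrow> bool" where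
  "sublinear_space M Ps H E \<longleftrightarrow>
     \<comment> \<open>H contains the constants and is closed under locally Lipschitz functions\<close>
     (\<forall>n \<phi> Xs. length Xs = n \<longrightarrow> set Xs \<subseteq> H \<longrightarrow> lLip n \<phi> \<longrightarrow> (\<lambda>\<omega>. \<phi> (rv_vec Xs \<omega>)) \<in> H) \<and>
     \<comment> \<open>monotonicity\<close>
     (\<forall>X\<in>H. \<forall>Y\<in>H. (\<forall>\<omega>\<in>space M. X \<omega> \<le> Y \<omega>) \<longrightarrow> E X \<le> E Y) \<and>
     \<comment> \<open>constant preserving\<close>
     (\<forall>c. E (\<lambda>_. c) = c) \<and>
     \<comment> \<open>positive homogeneity\<close>
     (\<forall>X\<in>H. \<forall>c::real. c > 0 \<longrightarrow> E (\<lambda>\<omega>. c * X \<omega>) = c * E X) \<and>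
     \<comment> \<open>sub-additivity\<close>
     (\<forall>X\<in>H. \<forall>Y\<in>H. E (\<lambda>\<omega>. X \<omega> + Y \<omega>) \<le> E X + E Y) \<and>
     \<comment> \<open>regularity: X_n decreasing to 0 implies E X_n to 0\<close>
     (\<forall>Xn. (\<forall>n. Xn n \<in> H) \<longrightarrow>
        (\<forall>\<omega>\<in>space M. decseq (\<lambda>n. Xn n \<omega>) \<and> (\<lambda>n. Xn n \<omega>) \<longlonglongrightarrow> 0) \<longrightarrow>
        (\<lambda>n. E (Xn n)) \<longlonglongrightarrow> 0) \<and>
     \<comment> \<open>countable sub-additivity\<close>
     (\<forall>X Xn. X \<in> H \<longrightarrow> (\<forall>n. Xn n \<in> H) \<longrightarrow>
        (\<forall>\<omega>\<in>space M. 0 \<le> X \<omega> \<and> (\<forall>n. 0 \<le> Xn n \<omega>) \<and> summable (\<lambda>n. Xn n \<omega>)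
            \<and> X \<omega> \<le> (\<Sum>n. Xn n \<omega>)) \<longrightarrow>
        summable (\<lambda>n. E (Xn n)) \<longrightarrow> E X \<le> (\<Sum>n. E (Xn n))) \<and>
     \<comment> \<open>representation E X = sup over P in Ps of E_P X\<close>
     Ps \<noteq> {} \<and>
     (\<forall>P\<in>Ps. prob_space P \<and> sets P = sets M) \<and>
     (\<forall>X\<in>H. (\<forall>P\<in>Ps. integrable P X) \<and>
        bdd_above ((\<lambda>P. integral\<^sup>L P X) ` Ps) \<and>
        E X = (SUP P\<in>Ps. integral\<^sup>L P X))"

definition cap :: "'a measure set \<Rightarrow> 'a set \<Rightarrow> real" where
  "cap Ps A = (SUP P\<in>Ps. measure P A)"

definition choquet_finite :: "'a measure \<Rightarrow> 'a measure set \<Rightarrow> ('a \<Rightarrow> real) \<Rightarrow> bool" where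
  "choquet_finite M Ps X \<longleftrightarrow>
     set_integrable lborel {0..} (\<lambda>x. cap Ps {\<omega>\<in>space M. X \<omega> > x}) \<and>
     set_integrable lborel {..<0} (\<lambda>x. cap Ps {\<omega>\<in>space M. X \<omega> > x} - 1)"

definition sl_indep :: "(('a \<Rightarrow> real) \<Rightarrow> real) \<Rightarrow> ('a \<Rightarrow> real) \<Rightarrow> ('a \<Rightarrow> real) list \<Rightarrow> bool" where
  "sl_indep E Y Xs \<longleftrightarrow>
     (\<forall>\<psi>. lLip (Suc (length Xs)) \<psi> \<longrightarrow>
        E (\<lambda>\<omega>. \<psi> (rv_vec (Xs @ [Y]) \<omega>)) =
        E (\<lambda>\<omega>. E (\<lambda>\<omega>'. \<psi> ((rv_vec Xs \<omega>)(length Xs := Y \<omega>')))))"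

definition sl_ident :: "(('a \<Rightarrow> real) \<Rightarrow> real) \<Rightarrow> ('a \<Rightarrow> real) \<Rightarrow> ('a \<Rightarrow> real) \<Rightarrow> bool" where
  "sl_ident E X Y \<longleftrightarrow>
     (\<forall>\<psi>. lLip 1 \<psi> \<longrightarrow> E (\<lambda>\<omega>. \<psi> (rv_vec [X] \<omega>)) = E (\<lambda>\<omega>. \<psi> (rv_vec [Y] \<omega>)))"

definition lattice :: "nat \<Rightarrow> nat list set" where
  "lattice d = {k. length k = d \<and> (\<forall>i\<in>set k. 1 \<le> i)}"

definition idx_le :: "nat list \<Rightarrow> nat list \<Rightarrow> bool" where
  "idx_le m n \<longleftrightarrow> list_all2 (\<le>) m n"

definition idx_abs :: "nat list \<Rightarrow> nat" where
  "idx_abs n = prod_list n"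

definition sl_indep_field ::
  "(('a \<Rightarrow> real) \<Rightarrow> real) \<Rightarrow> nat \<Rightarrow> (nat list \<Rightarrow> 'a \<Rightarrow> real) \<Rightarrow> bool" where
  "sl_indep_field E d X \<longleftrightarrow>
     (\<exists>en. bij_betw en UNIV (lattice d) \<and>
        (\<forall>n. sl_indep E (X (en n)) (map (\<lambda>j. X (en j)) [0..<n])))"

definition partial_sum :: "nat \<Rightarrow> (nat list \<Rightarrow> 'a \<Rightarrow> real) \<Rightarrow> nat list \<Rightarrow> 'a \<Rightarrow> real" where
  "partial_sum d X n \<omega> = (\<Sum>k\<in>{k\<in>lattice d. idx_le k n}. X k \<omega>)"

end

theory Submission
  imports Defs
begin

text \<open>Write \<open>N = |n|\<close>, \<open>\<epsilon> = c\<^sup>2\<close> and \<open>b = c N\<close>. Either some \<open>|X\<^sub>k|\<close> exceeds \<open>b\<close>, which costs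
  at most \<open>N\<close> times the capacity of \<open>|X| > N\<close>, or the sum of the variables truncated above at \<open>b\<close> exceeds
  \<open>\<epsilon> N\<close>. For the latter take the exponential Chebyshev inequality with exponent
  \<open>\<lambda> = (1/c) (ln b) powr \<alpha> / b\<close>, so that \<open>\<lambda> \<epsilon> N = (ln b) powr \<alpha>\<close>. On the truncated range \<open>\<lambda> x\<close> is at most
  \<open>(1/c) (ln x) powr \<alpha>\<close> up to a constant, and \<open>1/c < 1\<close>, so the moment condition bounds the second order
  term and the exponential moment of the sum stays bounded. The second case therefore costs only
  \<open>O(exp (- (ln N) powr \<alpha>))\<close>.

  The weighted sum of the first costs is compared with the Choquet integral by Abel summation. The
  counting estimate behind it splits the lattice by the position of the largest coordinate \<open>k\<close>: for a
  fixed product \<open>q\<close> of the others the weights are dominated by \<open>1/q\<close> times the increments of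
  \<open>exp ((ln t) powr \<alpha>)\<close>, which telescope, and summing \<open>1/q\<close> produces the factor
  \<open>(ln N) ^ (d - 1)\<close>.\<close>

section \<open>Exponential weights\<close>

lemma logp_nonneg: "0 \<le> logp x"
  by (simp add: logp_def)

lemma logp_eq_ln: "1 \<le> x \<Longrightarrow> logp x = ln x"
  by (simp add: logp_def)

lemma logp_mono: "x \<le> y \<Longrightarrow> logp x \<le> logp y"
  by (auto simp: logp_def)

lemma le_exp_logp: "x \<le> exp (logp x)"
  by (simp add: logp_def)

text \<open>A second order expansion whose linear term is the untruncated \<open>y\<close>, so that
  mean zero removes it; truncation survives only in the exponent of the remainder. For
  \<open>y\<close> above \<open>b\<close> the case \<open>y = b\<close> suffices, because the bound
  increases in \<open>y\<close> there.\<close>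

lemma exp_min_le:
  fixes l y b :: real
  assumes "0 \<le> l" "0 \<le> b"
  shows "exp (l * min y b) \<le> 1 + l * y + l\<^sup>2 * (y\<^sup>2 * exp (l * min (abs y) b))"
proof -
  \<comment> \<open>Multiply \<open>(1 - u) * exp u \<le> 1\<close> by \<open>1 + u\<close>.\<close>
  have *: "exp u \<le> 1 + u + u\<^sup>2 * exp u" if "0 \<le> u" for u :: real
  proof -
    have "(1 - u) * exp u \<le> 1"
      using exp_ge_add_one_self[of "-u"] mult_right_mono[of "1-u" "exp (-u)" "exp u"]
      by (simp add: exp_minus)
    hence "(1 + u) * ((1 - u) * exp u) \<le> (1 + u) * 1"
      using that by (intro mult_left_mono) auto
    thus ?thesis by (simp add: algebra_simps power2_eq_square)
  qed
  consider "y < 0" | "0 \<le> y" "y \<le> b" | "b < y" "0 \<le> y" by linarith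
  thus ?thesis
  proof cases
    case 1
    define w where "w = - (l * y)"
    have w: "0 \<le> w" using 1 assms by (simp add: w_def mult_nonneg_nonpos)
    \<comment> \<open>The product equals \<open>1 + w ^ 3\<close>; hence
      \<open>1 - w + w\<^sup>2\<close> dominates \<open>1 / (1 + w)\<close> and so
      \<open>exp (- w)\<close>.\<close>
    have "(1 - w + w\<^sup>2) * (1 + w) \<ge> 1"
      using w by (simp add: algebra_simps power2_eq_square)
    moreover have "1 - w + w\<^sup>2 \<ge> 0"
      using sum_squares_ge_zero[of "w - 1/2" 0] by (simp add: power2_eq_square algebra_simps)
    ultimately have "(1 - w + w\<^sup>2) * exp w \<ge> 1"
      using mult_left_mono[OF exp_ge_add_one_self[of w], of "1 - w + w\<^sup>2"] by linarith
    hence "exp (- w) \<le> 1 - w + w\<^sup>2"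
      by (simp add: exp_minus field_simps)
    hence "exp (l * y) \<le> 1 + l * y + l\<^sup>2 * y\<^sup>2"
      by (simp add: w_def power_mult_distrib)
    also have "l\<^sup>2 * y\<^sup>2 \<le> l\<^sup>2 * (y\<^sup>2 * exp (l * min (abs y) b))"
      using assms mult_left_mono[of 1 "exp (l * min (abs y) b)" "y\<^sup>2"] by (intro mult_left_mono) auto
    finally show ?thesis using 1 assms by (simp add: min_def)
  next
    case 2
    thus ?thesis using *[of "l * y"] assms by (simp add: min_def power_mult_distrib)
  next
    case 3
    have "exp (l * b) \<le> 1 + l * b + (l * b)\<^sup>2 * exp (l * b)"
      using *[of "l * b"] assms by simp
    also have "\<dots> \<le> 1 + l * y + (l * y)\<^sup>2 * exp (l * b)"
      using assms 3 by (intro add_mono mult_right_mono power_mono mult_left_mono) auto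
    finally show ?thesis using 3 by (simp add: min_def power_mult_distrib)
  qed
qed

text \<open>The function \<open>t \<mapsto> (ln t) powr \<alpha> / t\<close> decreases from \<open>exp \<alpha>\<close> on, so a chord
  of slope \<open>(ln b) powr \<alpha> / b\<close> stays below \<open>(ln x) powr \<alpha>\<close> up to a constant.\<close>

lemma chord_le_logp_powr:
  fixes \<theta> \<alpha> b x :: real
  assumes "0 \<le> \<theta>" "\<theta> \<le> 1" "1 < \<alpha>" "1 < b" "0 \<le> x"
  shows "\<theta> * (ln b) powr \<alpha> / b * min x b \<le> \<alpha> powr \<alpha> * exp \<alpha> + \<theta> * logp x powr \<alpha>"
proof -
  have c0: "0 \<le> \<alpha> powr \<alpha> * exp \<alpha>" "0 \<le> \<theta> * logp x powr \<alpha>"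
    using assms by auto
  consider "b \<le> x" | "x < b" "x \<le> exp \<alpha>" | "x < b" "exp \<alpha> < x" by linarith
  thus ?thesis
  proof cases
    case 1
    have "\<theta> * (ln b) powr \<alpha> / b * min x b = \<theta> * (ln b) powr \<alpha>"
      using 1 assms by (simp add: min_def)
    also have "\<dots> \<le> \<theta> * logp x powr \<alpha>"
      using 1 assms by (intro mult_left_mono powr_mono2) (auto simp: logp_eq_ln)
    finally show ?thesis using c0 by linarith
  next
    case 2
    \<comment> \<open>For small \<open>x\<close> both factors are bounded: the slope by
      \<open>\<alpha> powr \<alpha>\<close>, the truncated variable by \<open>exp \<alpha>\<close>.
      Their product is the additive constant.\<close>
    have "(ln b) powr \<alpha> / b \<le> \<alpha> powr \<alpha>"
      using ln_powr_bound2[of b \<alpha>] assms by (simp add: field_simps)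
    hence "\<theta> * ((ln b) powr \<alpha> / b) \<le> 1 * \<alpha> powr \<alpha>"
      using assms by (intro mult_mono) auto
    hence "\<theta> * (ln b) powr \<alpha> / b * min x b \<le> \<alpha> powr \<alpha> * exp \<alpha>"
      using assms 2 by (intro mult_mono) auto
    thus ?thesis using c0 by linarith
  next
    case 3
    have x1: "1 < x" using 3(2) assms by (smt (verit) one_less_exp_iff)
    have lx: "\<alpha> < ln x" using 3(2) x1 exp_less_cancel_iff[of \<alpha> "ln x"] by simp
    \<comment> \<open>The monotonicity without derivatives: since \<open>ln x\<close> exceeds
      \<alpha>, \<open>u\<close> is at most \<open>ln x * u / \<alpha>\<close>, and raising
      \<open>1 + u / \<alpha> \<le> exp (u / \<alpha>)\<close> to the power \<alpha> leaves exactly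
      \<open>exp u = b / x\<close>.\<close>
    define u where "u = ln b - ln x"
    have u: "0 \<le> u" using 3 x1 by (simp add: u_def)
    have "ln b = ln x + u" by (simp add: u_def)
    also have "\<dots> \<le> ln x * (1 + u / \<alpha>)"
      using mult_right_mono[of "\<alpha>" "ln x" "u / \<alpha>"] lx u assms by (simp add: algebra_simps)
    also have "\<dots> \<le> ln x * exp (u / \<alpha>)"
      using lx assms by (intro mult_left_mono exp_ge_add_one_self) auto
    finally have "(ln b) powr \<alpha> \<le> (ln x * exp (u / \<alpha>)) powr \<alpha>"
      using assms by (intro powr_mono2) auto
    also have "\<dots> = (ln x) powr \<alpha> * exp u"
      using lx assms by (simp add: powr_mult exp_powr_real)
    also have "exp u = b / x"
      using 3 x1 by (simp add: u_def exp_diff)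
    finally have "(ln b) powr \<alpha> / b * x \<le> (ln x) powr \<alpha>"
      using assms x1 by (simp add: field_simps)
    hence "\<theta> * ((ln b) powr \<alpha> / b * x) \<le> \<theta> * logp x powr \<alpha>"
      using assms x1 by (intro mult_left_mono) (auto simp: logp_eq_ln)
    thus ?thesis using 3 add_increasing[OF c0(1)] by (simp add: min_def mult.assoc)
  qed
qed

text \<open>At \<open>\<bar>X0 \<omega>\<bar>\<close> and with \<open>m = d - 1\<close> this is the
  variable whose Choquet integral is assumed finite.\<close>

definition moment_fun :: "real \<Rightarrow> nat \<Rightarrow> real \<Rightarrow> real" where
  "moment_fun \<alpha> m x = exp (logp x powr \<alpha>) * logp x ^ m"

lemma moment_fun_nonneg: "0 \<le> moment_fun \<alpha> m x"
  by (simp add: moment_fun_def logp_nonneg)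

lemma moment_fun_mono:
  assumes "0 \<le> \<alpha>" "x \<le> y"
  shows "moment_fun \<alpha> m x \<le> moment_fun \<alpha> m y"
  unfolding moment_fun_def using assms
  by (intro mult_mono power_mono) (auto intro!: powr_mono2 simp: logp_nonneg logp_mono)

text \<open>The moment function can vanish for small \<open>x\<close>, hence the added 1. Where
  \<open>logp x \<le> 1\<close> the left side is bounded; elsewhere
  \<open>1 + logp x \<le> 2 * logp x\<close>.\<close>

lemma exp_powr_logp_le:
  assumes "0 \<le> \<alpha>"
  shows "exp (logp x powr \<alpha>) * (1 + logp x) ^ m \<le> 2 ^ m * exp 1 * (1 + moment_fun \<alpha> m x)"
proof (cases "logp x \<le> 1")
  case True
  have "logp x powr \<alpha> \<le> 1 powr \<alpha>"
    using assms True logp_nonneg by (intro powr_mono2) auto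
  hence "exp (logp x powr \<alpha>) * (1 + logp x) ^ m \<le> exp 1 * 2 ^ m"
    using True logp_nonneg by (intro mult_mono power_mono) auto
  also have "\<dots> \<le> exp 1 * 2 ^ m * (1 + moment_fun \<alpha> m x)"
    using moment_fun_nonneg[of \<alpha> m x] by simp
  finally show ?thesis by (simp add: mult_ac)
next
  case False
  have "exp (logp x powr \<alpha>) * (1 + logp x) ^ m \<le> exp (logp x powr \<alpha>) * (2 * logp x) ^ m"
    using False by (intro mult_left_mono power_mono) auto
  also have "\<dots> = 2 ^ m * 1 * moment_fun \<alpha> m x"
    by (simp add: moment_fun_def power_mult_distrib)
  also have "\<dots> \<le> 2 ^ m * exp 1 * (1 + moment_fun \<alpha> m x)"
    using moment_fun_nonneg[of \<alpha> m x] by (intro mult_mono) auto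
  finally show ?thesis .
qed

text \<open>The slack \<open>1 - \<theta>\<close> in the exponent absorbs the square:
  \<open>x\<^sup>2\<close> is at most \<open>exp (2 * L)\<close> with
  \<open>L = logp \<bar>x\<bar>\<close>, and \<open>(1 - \<theta>) * L powr \<alpha>\<close>
  outgrows \<open>2 * L\<close> because \<alpha> exceeds 1.\<close>

lemma square_exp_le_moment_fun:
  assumes "\<theta> < 1" "1 < \<alpha>"
  shows "\<exists>K>0. \<forall>x. x\<^sup>2 * exp (\<theta> * logp \<bar>x\<bar> powr \<alpha>) \<le> K * (1 + moment_fun \<alpha> m \<bar>x\<bar>)"
proof -
  \<comment> \<open>The positive solution of
    \<open>2 * L = (1 - \<theta>) * L powr \<alpha>\<close>.\<close>
  define L1 where "L1 = (2 / (1 - \<theta>)) powr (1 / (\<alpha> - 1))"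
  have *: "2 * L + \<theta> * L powr \<alpha> \<le> 2 * L1 + L powr \<alpha>" if "0 \<le> L" for L
  proof (cases "L \<le> L1")
    case True
    moreover have "\<theta> * L powr \<alpha> \<le> 1 * L powr \<alpha>"
      using assms by (intro mult_right_mono) auto
    ultimately show ?thesis by simp
  next
    case False
    have L1: "0 < L1" using assms by (simp add: L1_def)
    have "2 / (1 - \<theta>) = L1 powr (\<alpha> - 1)"
      using assms by (simp add: L1_def powr_powr)
    also have "\<dots> \<le> L powr (\<alpha> - 1)"
      using False assms L1 by (intro powr_mono2) auto
    finally have "L * 2 / (1 - \<theta>) \<le> L * L powr (\<alpha> - 1)"
      using that mult_left_mono by fastforce
    also have "\<dots> = L powr \<alpha>"
      using that False L1 powr_mult_base[of L "\<alpha> - 1"] by simp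
    finally have "2 * L \<le> (1 - \<theta>) * L powr \<alpha>"
      using assms by (simp add: field_simps)
    thus ?thesis using L1 by (simp add: algebra_simps)
  qed
  show ?thesis
  proof (intro exI[of _ "exp (2 * L1) * (2 ^ m * exp 1)"] conjI allI)
    fix x :: real
    define L where "L = logp \<bar>x\<bar>"
    have L0: "0 \<le> L" by (simp add: L_def logp_nonneg)
    have "x\<^sup>2 = \<bar>x\<bar>\<^sup>2" by simp
    also have "\<dots> \<le> (exp L)\<^sup>2"
      unfolding L_def using le_exp_logp by (intro power_mono) auto
    also have "\<dots> = exp (2 * L)" by (simp add: exp_double)
    finally have "x\<^sup>2 * exp (\<theta> * L powr \<alpha>) \<le> exp (2 * L) * exp (\<theta> * L powr \<alpha>)"
      by (intro mult_right_mono) auto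
    also have "\<dots> \<le> exp (2 * L1) * exp (L powr \<alpha>)"
      using *[OF L0] by (simp flip: exp_add)
    also have "\<dots> \<le> exp (2 * L1) * (exp (L powr \<alpha>) * (1 + L) ^ m)"
      using L0 by (intro mult_left_mono) auto
    also have "\<dots> \<le> exp (2 * L1) * (2 ^ m * exp 1 * (1 + moment_fun \<alpha> m \<bar>x\<bar>))"
      unfolding L_def using exp_powr_logp_le[of \<alpha>] assms by (intro mult_left_mono) auto
    finally show "x\<^sup>2 * exp (\<theta> * logp \<bar>x\<bar> powr \<alpha>)
        \<le> exp (2 * L1) * (2 ^ m * exp 1) * (1 + moment_fun \<alpha> m \<bar>x\<bar>)"
      by (simp add: L_def mult_ac)
  qed simp
qed

text \<open>Up to the factor \<open>\<alpha>\<close>, this is the derivative of \<open>exp ((ln t) powr \<alpha>)\<close>.\<close>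

definition weight_fun :: "real \<Rightarrow> real \<Rightarrow> real" where
  "weight_fun \<alpha> t = exp (logp t powr \<alpha>) * logp t powr (\<alpha> - 1) / t"

lemma weight_fun_nonneg: "0 \<le> t \<Longrightarrow> 0 \<le> weight_fun \<alpha> t"
  by (simp add: weight_fun_def)

text \<open>A step of \<open>k\<close> moves \<open>t = q * k\<close> by \<open>q\<close>, so the
  increment should be about \<open>q\<close> times the derivative. The weight sits at the right
  endpoint, where it could be far larger than over the rest of the step;
  \<open>q \<le> k ^ m\<close> bounds the growth within one step by making \<open>ln (q * k)\<close>
  comparable to \<open>ln k\<close>.\<close>

lemma weight_fun_le_increment:
  fixes \<alpha> :: real and q k m :: nat
  assumes "1 < \<alpha>" "1 \<le> q" "1 \<le> k" "q \<le> k ^ m"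
  shows "weight_fun \<alpha> (real (q * k))
    \<le> (1 + ((Suc m) * (\<alpha> - 1)) powr (\<alpha> - 1)) / real q *
      (exp (logp (real (q * k)) powr \<alpha>) - exp (logp (real (q * (k - 1))) powr \<alpha>))"
proof (cases "k = 1")
  case True
  \<comment> \<open>Both sides vanish here: \<open>logp\<close> is 0 at 1 and at 0, and 0 raised to
    \<open>\<alpha> - 1\<close> is 0.\<close>
  hence "q = 1" using assms by simp
  thus ?thesis using True by (simp add: weight_fun_def logp_def)
next
  case False
  hence k2: "2 \<le> k" using assms by simp
  define b a where "b = ln (real (q * k))" and "a = ln (real (q * (k - 1)))"
  have pos: "0 < q * k" "0 < q * (k - 1)" using assms k2 by auto
  have ge1: "1 \<le> real (q * k)" "1 \<le> real (q * (k - 1))"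
    unfolding real_of_nat_ge_one_iff using pos by linarith+
  have lb: "logp (real (q * k)) = b" "logp (real (q * (k - 1))) = a"
    unfolding a_def b_def by (rule logp_eq_ln[OF ge1(1)], rule logp_eq_ln[OF ge1(2)])
  have a0: "0 \<le> a"
    unfolding a_def using ge1 by (intro ln_ge_zero)
  have "real (q * (k - 1)) < real (q * k)"
    unfolding of_nat_less_iff using assms k2 by (intro mult_strict_left_mono) auto
  hence ab: "a \<le> b" "b > 0"
    unfolding a_def b_def using ge1 by (simp_all only: ln_le_cancel_iff less_imp_le ln_gt_zero)
  have "b - a = - ln (real (q * (k - 1)) / real (q * k))"
    unfolding a_def b_def using pos by (subst ln_div) (auto)
  also have "real (q * (k - 1)) / real (q * k) = 1 - 1 / k"
    using assms by (simp add: of_nat_diff field_simps)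
  also have "- ln (1 - 1 / k) \<ge> 1 / k"
    using k2 ln_le_minus_one[of "1 - 1/real k"] by simp
  finally have ba: "1 / k \<le> b - a" .
  \<comment> \<open>The weight is \<open>exp (b powr \<alpha>) * y / q\<close>, and \<open>y\<close>
    is a lower bound for the growth of the exponent over the step. \<open>Y\<close> bounds
    \<open>y\<close> from above, so that the relative increment, at least
    \<open>y / (1 + y)\<close>, is at least \<open>y / (1 + Y)\<close>.\<close>
  define y where "y = b powr (\<alpha> - 1) / k"
  define Y where "Y = (Suc m * (\<alpha> - 1)) powr (\<alpha> - 1)"
  have y0: "0 \<le> y" by (simp add: y_def)
  have "b \<le> ln (real (k ^ Suc m))"
    unfolding b_def using assms pos by (subst ln_le_cancel_iff) (auto simp flip: of_nat_mult simp: mult_ac)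
  also have "\<dots> = Suc m * ln k"
    unfolding of_nat_power by (rule ln_realpow)
  finally have "b powr (\<alpha> - 1) \<le> (Suc m * ln k) powr (\<alpha> - 1)"
    using ab assms by (intro powr_mono2) auto
  also have "\<dots> = Suc m powr (\<alpha> - 1) * ln k powr (\<alpha> - 1)"
    using k2 by (simp add: powr_mult)
  also have "\<dots> \<le> Suc m powr (\<alpha> - 1) * ((\<alpha> - 1) powr (\<alpha> - 1) * k)"
    using assms k2 by (intro mult_left_mono ln_powr_bound2) auto
  also have "\<dots> = Y * k"
    unfolding Y_def using assms by (subst powr_mult) auto
  finally have yY: "y \<le> Y"
    using k2 by (simp add: y_def field_simps)
  have "a powr \<alpha> \<le> a * b powr (\<alpha> - 1)"
  proof -
    have "a powr \<alpha> = a * a powr (\<alpha> - 1)"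
      using a0 powr_mult_base[of a "\<alpha> - 1"] by simp
    also have "\<dots> \<le> a * b powr (\<alpha> - 1)"
      using a0 ab assms by (intro mult_left_mono powr_mono2) auto
    finally show ?thesis .
  qed
  moreover have "b powr \<alpha> = b * b powr (\<alpha> - 1)"
    using ab powr_mult_base[of b "\<alpha> - 1"] by simp
  ultimately have "(b - a) * b powr (\<alpha> - 1) \<le> b powr \<alpha> - a powr \<alpha>"
    by (simp add: algebra_simps)
  moreover have "1 / k * b powr (\<alpha> - 1) \<le> (b - a) * b powr (\<alpha> - 1)"
    using ba by (intro mult_right_mono) auto
  ultimately have "y \<le> b powr \<alpha> - a powr \<alpha>"
    by (simp add: y_def)
  hence "exp (a powr \<alpha>) \<le> exp (b powr \<alpha> - y)" by simp
  also have "\<dots> = exp (b powr \<alpha>) * exp (- y)" by (simp flip: exp_add)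
  also have "exp (- y) \<le> 1 / (1 + y)"
    using exp_ge_add_one_self[of y] y0 by (simp add: exp_minus field_simps)
  finally have "exp (b powr \<alpha>) * (y / (1 + y)) \<le> exp (b powr \<alpha>) - exp (a powr \<alpha>)"
    using y0 by (simp add: field_simps)
  moreover have "exp (b powr \<alpha>) * (y / (1 + Y)) \<le> exp (b powr \<alpha>) * (y / (1 + y))"
    using y0 yY by (intro mult_left_mono divide_left_mono) auto
  ultimately have "exp (b powr \<alpha>) * y / (1 + Y) \<le> exp (b powr \<alpha>) - exp (a powr \<alpha>)"
    by simp
  hence "exp (b powr \<alpha>) * y \<le> (1 + Y) * (exp (b powr \<alpha>) - exp (a powr \<alpha>))"
    using y0 yY by (simp add: pos_divide_le_eq mult.commute)
  hence "exp (b powr \<alpha>) * y / q \<le> (1 + Y) * (exp (b powr \<alpha>) - exp (a powr \<alpha>)) / q"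
    by (intro divide_right_mono) auto
  thus ?thesis
    unfolding weight_fun_def lb Y_def[symmetric] using assms by (simp add: y_def field_simps)
qed

section \<open>Weighted sums over the lattice\<close>

lemma sum_prod_list_lists:
  fixes f :: "'b \<Rightarrow> 'c :: comm_semiring_1"
  assumes "finite A"
  shows "(\<Sum>xs | set xs \<subseteq> A \<and> length xs = n. prod_list (map f xs)) = (\<Sum>x\<in>A. f x) ^ n"
proof (induction n)
  case 0
  have "{xs. set xs \<subseteq> A \<and> length xs = 0} = {[]}" by auto
  thus ?case by simp
next
  case (Suc n)
  let ?L = "{xs. set xs \<subseteq> A \<and> length xs = n}"
  have "(\<Sum>xs | set xs \<subseteq> A \<and> length xs = Suc n. prod_list (map f xs))
      = (\<Sum>(xs, x)\<in>?L \<times> A. f x * prod_list (map f xs))"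
    unfolding lists_length_Suc_eq by (subst sum.reindex) (auto simp: inj_on_def case_prod_unfold)
  also have "\<dots> = (\<Sum>x\<in>A. f x) ^ Suc n"
    by (simp add: sum.cartesian_product[symmetric] sum_distrib_right[symmetric]
        sum_distrib_left[symmetric] Suc mult.commute)
  finally show ?case .
qed

lemma lattice_nth_ge_1: "n \<in> lattice d \<Longrightarrow> i < d \<Longrightarrow> 1 \<le> n ! i"
  by (auto simp: lattice_def)

lemma prod_list_ge_1:
  fixes xs :: "nat list"
  shows "\<forall>x\<in>set xs. 1 \<le> x \<Longrightarrow> 1 \<le> prod_list xs"
  by (induction xs) auto

lemma le_prod_list:
  fixes xs :: "nat list"
  assumes "\<forall>x\<in>set xs. 1 \<le> x" "x \<in> set xs"
  shows "x \<le> prod_list xs"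
  using assms
proof (induction xs)
  case (Cons a xs)
  have "1 \<le> prod_list xs"
    using Cons.prems by (intro prod_list_ge_1) auto
  moreover have "1 \<le> a" using Cons.prems by simp
  ultimately have "a \<le> a * prod_list xs" "prod_list xs \<le> a * prod_list xs" by simp_all
  moreover have "x = a \<or> x \<le> prod_list xs" using Cons by auto
  ultimately show ?case by (auto intro: order_trans)
qed simp

lemma idx_abs_ge_1: "n \<in> lattice d \<Longrightarrow> 1 \<le> idx_abs n"
  using prod_list_ge_1 by (simp add: lattice_def idx_abs_def)

text \<open>No coordinate exceeds the product, as all are at least 1. The enclosing box gives
  finiteness and lets sums factor by coordinates.\<close>

lemma lattice_idx_abs_le_subset:
  "{n \<in> lattice d. idx_abs n \<le> N} \<subseteq> {xs. set xs \<subseteq> {1..N} \<and> length xs = d}"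
proof
  fix n assume n: "n \<in> {n \<in> lattice d. idx_abs n \<le> N}"
  have "x \<in> {1..N}" if "x \<in> set n" for x
    using n le_prod_list[of n x] that by (auto simp: lattice_def idx_abs_def)
  thus "n \<in> {xs. set xs \<subseteq> {1..N} \<and> length xs = d}"
    using n by (auto simp: lattice_def)
qed

lemma finite_lattice_idx_abs_le: "finite {n \<in> lattice d. idx_abs n \<le> N}"
  by (rule finite_subset[OF lattice_idx_abs_le_subset finite_lists_length_eq]) simp

lemma card_idx_le:
  assumes "n \<in> lattice d"
  shows "finite {k \<in> lattice d. idx_le k n}" "card {k \<in> lattice d. idx_le k n} = idx_abs n"
proof -
  have "finite {k \<in> lattice (length n). idx_le k n}
      \<and> card {k \<in> lattice (length n). idx_le k n} = idx_abs n"
  proof (induction n)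
    case Nil
    have "{k \<in> lattice 0. idx_le k []} = {[]}" by (auto simp: lattice_def idx_le_def)
    thus ?case by (simp add: idx_abs_def)
  next
    case (Cons a n)
    have "{k \<in> lattice (length (a # n)). idx_le k (a # n)}
        = (\<lambda>(x, xs). x # xs) ` ({1..a} \<times> {k \<in> lattice (length n). idx_le k n})"
      by (auto simp: lattice_def idx_le_def list_all2_Cons2 image_iff)
    moreover have "inj_on (\<lambda>(x, xs). x # xs) ({1..a} \<times> {k \<in> lattice (length n). idx_le k n})"
      by (auto simp: inj_on_def)
    ultimately show ?case
      using Cons by (simp add: card_image card_cartesian_product idx_abs_def)
  qed
  moreover have "length n = d" using assms by (simp add: lattice_def)
  ultimately show "finite {k \<in> lattice d. idx_le k n}"
    "card {k \<in> lattice d. idx_le k n} = idx_abs n" by auto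
qed

lemma harm_le_ln: "1 \<le> n \<Longrightarrow> harm n \<le> 1 + ln (real n)"
proof (induction n rule: dec_induct)
  case base
  show ?case by (simp add: harm_def)
next
  case (step n)
  have "ln (real n / real (Suc n)) \<le> real n / real (Suc n) - 1"
    using step by (intro ln_le_minus_one) auto
  hence "1 / real (Suc n) \<le> ln (real (Suc n)) - ln (real n)"
    using step by (simp add: ln_div field_simps)
  thus ?case using step by (simp add: harm_Suc inverse_eq_divide)
qed

text \<open>In the regime where the distinguished coordinate \<open>k\<close> is at least a fixed root of \<open>q\<close>,
  the increments of \<open>exp ((ln t) powr \<alpha>)\<close> telescope.\<close>

lemma sum_weight_fun_one_coordinate:
  fixes \<alpha> :: real and q m N :: nat
  assumes "1 < \<alpha>" "1 \<le> q"
  shows "(\<Sum>k | 1 \<le> k \<and> q \<le> k ^ m \<and> q * k \<le> N. weight_fun \<alpha> (real (q * k)))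
    \<le> (1 + ((Suc m) * (\<alpha> - 1)) powr (\<alpha> - 1)) / real q * exp (logp (real N) powr \<alpha>)"
    (is "sum _ ?S \<le> ?Y / _ * _")
proof -
  define F where "F = (\<lambda>k. exp (logp (real (q * k)) powr \<alpha>))"
  define K where "K = N div q"
  have Fmono: "F j \<le> F k" if "j \<le> k" for j k
    unfolding F_def using assms that
    by (auto intro!: powr_mono2 logp_mono mult_left_mono simp: logp_nonneg)
  have sub: "?S \<subseteq> {1..K}"
    using assms by (auto simp: K_def less_eq_div_iff_mult_less_eq mult.commute)
  have "(\<Sum>k\<in>?S. weight_fun \<alpha> (real (q * k))) \<le> (\<Sum>k\<in>?S. ?Y / real q * (F k - F (k - 1)))"
    unfolding F_def using assms by (intro sum_mono weight_fun_le_increment) auto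
  \<comment> \<open>Dropping the condition \<open>q \<le> k ^ m\<close> only adds nonnegative
    increments and leaves a gapless range that telescopes.\<close>
  also have "\<dots> \<le> (\<Sum>k\<in>{1..K}. ?Y / real q * (F k - F (k - 1)))"
  proof (intro sum_mono2 sub)
    fix k
    have "0 \<le> F k - F (k - 1)" using Fmono[of "k - 1" k] by simp
    moreover have "0 \<le> ?Y / real q" by (auto intro!: add_nonneg_nonneg)
    ultimately show "0 \<le> ?Y / real q * (F k - F (k - 1))" by (rule mult_nonneg_nonneg[rotated])
  qed simp
  also have "\<dots> = ?Y / real q * (\<Sum>k\<in>{1..K}. F k - F (k - 1))"
    by (simp add: sum_distrib_left)
  also have "(\<Sum>k\<in>{1..K}. F k - F (k - 1)) = F K - F 0"
    by (induction K) auto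
  also have "?Y / real q * (F K - F 0) \<le> ?Y / real q * exp (logp (real N) powr \<alpha>)"
  proof (intro mult_left_mono)
    have "q * K \<le> N" by (simp add: K_def)
    hence "F K \<le> exp (logp (real N) powr \<alpha>)"
      unfolding F_def using assms by (auto intro!: powr_mono2 logp_mono simp: logp_nonneg simp flip: of_nat_mult)
    moreover have "0 \<le> F 0" by (simp add: F_def)
    ultimately show "F K - F 0 \<le> exp (logp (real N) powr \<alpha>)" by linarith
  qed (auto intro!: add_nonneg_nonneg)
  finally show ?thesis .
qed

text \<open>Deleting a largest coordinate leaves \<open>m\<close> coordinates whose product is at
  most its \<open>m\<close>-th power, the regime of the one-coordinate estimate. Summing the
  reciprocal products over the whole box factors into \<open>harm N ^ m\<close>, the source of the
  power of the logarithm.\<close>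

lemma sum_weight_fun_lattice_max:
  fixes \<alpha> :: real and m N i :: nat
  assumes "1 < \<alpha>" "1 \<le> N" "i < Suc m"
  shows "(\<Sum>n | n \<in> lattice (Suc m) \<and> idx_abs n \<le> N \<and> (\<forall>j<Suc m. n ! j \<le> n ! i).
      weight_fun \<alpha> (real (idx_abs n)))
    \<le> (1 + ((Suc m) * (\<alpha> - 1)) powr (\<alpha> - 1)) * (exp (logp (real N) powr \<alpha>) * (1 + logp (real N)) ^ m)"
    (is "sum _ ?A \<le> ?Y * _")
proof -
  define B where "B = {xs. set xs \<subseteq> {1..N} \<and> length xs = m}"
  define T where "T = (\<lambda>q. {k. 1 \<le> k \<and> q \<le> k ^ m \<and> q * k \<le> N})"
  \<comment> \<open>Separates the other coordinates from coordinate \<open>i\<close>. Injectivity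
    and an image inside the Sigma set suffice for an upper bound, as the weights are
    nonnegative.\<close>
  define \<phi> where "\<phi> = (\<lambda>n :: nat list. (take i n @ drop (Suc i) n, n ! i))"
  have finB: "finite B" unfolding B_def by (intro finite_lists_length_eq) simp
  have q1: "1 \<le> prod_list q" if "q \<in> B" for q
  proof -
    have "q \<in> lattice m" using that by (auto simp: B_def lattice_def)
    thus ?thesis using idx_abs_ge_1 by (simp add: idx_abs_def)
  qed
  have finT: "finite (T (prod_list q))" if "q \<in> B" for q
  proof (rule finite_subset)
    show "T (prod_list q) \<subseteq> {..N}"
    proof
      fix k assume "k \<in> T (prod_list q)"
      hence "prod_list q * k \<le> N" by (simp add: T_def)
      moreover have "1 * k \<le> prod_list q * k" using q1[OF that] by (rule mult_right_mono) simp
      ultimately show "k \<in> {..N}" by (simp only: mult_1 atMost_iff order_trans[of k "prod_list q * k" N])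
    qed
  qed simp
  have split: "n = take i n @ n ! i # drop (Suc i) n" if "length n = Suc m" for n :: "nat list"
    using that assms by (simp add: id_take_nth_drop)
  have abs: "idx_abs n = prod_list (fst (\<phi> n)) * snd (\<phi> n)" if "length n = Suc m" for n
    using arg_cong[OF split[OF that], of prod_list] by (simp add: idx_abs_def \<phi>_def mult_ac)
  have inj: "inj_on \<phi> ?A"
  proof
    fix x y assume xy: "x \<in> ?A" "y \<in> ?A" "\<phi> x = \<phi> y"
    hence l: "length x = Suc m" "length y = Suc m" by (auto simp: lattice_def)
    have "length (take i x) = length (take i y)" using l by simp
    hence "take i x = take i y \<and> drop (Suc i) x = drop (Suc i) y \<and> x ! i = y ! i"
      using xy(3) by (simp add: \<phi>_def)
    thus "x = y" using split[OF l(1)] split[OF l(2)] by metis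
  qed
  have maps: "\<phi> ` ?A \<subseteq> (SIGMA q:B. T (prod_list q))"
  proof (rule image_subsetI)
    fix n assume n: "n \<in> ?A"
    hence l: "length n = Suc m" by (auto simp: lattice_def)
    have "set n \<subseteq> {1..N}" using lattice_idx_abs_le_subset n by blast
    moreover have "set (fst (\<phi> n)) \<subseteq> set n"
      by (auto simp: \<phi>_def dest: in_set_takeD in_set_dropD)
    ultimately have inB: "fst (\<phi> n) \<in> B"
      using l assms by (auto simp: B_def \<phi>_def)
    have bound: "x \<le> n ! i" if "x \<in> set (fst (\<phi> n))" for x
    proof -
      have "x \<in> set n" using that \<open>set (fst (\<phi> n)) \<subseteq> set n\<close> by blast
      then obtain j where "j < length n" "x = n ! j" by (auto simp: in_set_conv_nth)
      thus ?thesis using n l by simp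
    qed
    have "prod_list xs \<le> K ^ length xs" if "\<forall>x\<in>set xs. x \<le> K" for xs and K :: nat
      using that by (induction xs) (auto intro: mult_le_mono)
    hence "prod_list (fst (\<phi> n)) \<le> (n ! i) ^ length (fst (\<phi> n))"
      using bound by blast
    moreover have "length (fst (\<phi> n)) = m" using inB by (simp add: B_def)
    moreover have "1 \<le> n ! i" using n assms lattice_nth_ge_1 by blast
    ultimately have "n ! i \<in> T (prod_list (fst (\<phi> n)))"
      using n abs[OF l] by (auto simp: T_def \<phi>_def)
    thus "\<phi> n \<in> (SIGMA q:B. T (prod_list q))"
      using inB by (auto simp: \<phi>_def)
  qed
  have "(\<Sum>n\<in>?A. weight_fun \<alpha> (real (idx_abs n)))
      = (\<Sum>(q, k)\<in>\<phi> ` ?A. weight_fun \<alpha> (real (prod_list q * k)))"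
    by (subst sum.reindex[OF inj]) (auto intro!: sum.cong simp: case_prod_unfold abs lattice_def)
  also have "\<dots> \<le> (\<Sum>(q, k)\<in>(SIGMA q:B. T (prod_list q)). weight_fun \<alpha> (real (prod_list q * k)))"
    using maps finB finT by (intro sum_mono2) (auto simp: weight_fun_nonneg)
  also have "\<dots> = (\<Sum>q\<in>B. \<Sum>k\<in>T (prod_list q). weight_fun \<alpha> (real (prod_list q * k)))"
    using finB finT by (subst sum.Sigma) auto
  also have "\<dots> \<le> (\<Sum>q\<in>B. ?Y / real (prod_list q) * exp (logp (real N) powr \<alpha>))"
    unfolding T_def using q1 assms by (intro sum_mono sum_weight_fun_one_coordinate) auto
  also have "\<dots> = ?Y * exp (logp (real N) powr \<alpha>) * (\<Sum>q\<in>B. prod_list (map (\<lambda>j. 1 / real j) q))"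
  proof -
    have "prod_list (map (\<lambda>j. 1 / real j) q) = 1 / real (prod_list q)" for q
      by (induction q) auto
    thus ?thesis by (simp add: sum_distrib_left)
  qed
  also have "(\<Sum>q\<in>B. prod_list (map (\<lambda>j. 1 / real j) q)) = harm N ^ m"
    unfolding B_def by (subst sum_prod_list_lists) (auto simp: harm_def inverse_eq_divide)
  also have "?Y * exp (logp (real N) powr \<alpha>) * harm N ^ m
      \<le> ?Y * exp (logp (real N) powr \<alpha>) * (1 + logp (real N)) ^ m"
    using assms harm_le_ln[of N] harm_nonneg[of N, where 'a = real]
    by (intro mult_left_mono power_mono) (auto simp: logp_eq_ln intro!: add_nonneg_nonneg)
  finally show ?thesis by (simp add: mult_ac)
qed

text \<open>Every point has a largest coordinate, at one of \<open>Suc m\<close> positions. Ties are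
  counted several times, which is harmless for nonnegative weights.\<close>

lemma sum_weight_fun_lattice:
  fixes \<alpha> :: real and m :: nat
  assumes "1 < \<alpha>"
  shows "\<exists>C>0. \<forall>N\<ge>1. (\<Sum>n | n \<in> lattice (Suc m) \<and> idx_abs n \<le> N. weight_fun \<alpha> (real (idx_abs n)))
    \<le> C * (1 + moment_fun \<alpha> m (real N))"
proof (intro exI[of _ "Suc m * ((1 + ((Suc m) * (\<alpha> - 1)) powr (\<alpha> - 1)) * (2 ^ m * exp 1))"]
    conjI allI impI)
  let ?Y = "1 + ((Suc m) * (\<alpha> - 1)) powr (\<alpha> - 1)"
  have Y: "0 < ?Y" using powr_ge_zero by (intro add_pos_nonneg) auto
  thus "0 < Suc m * (?Y * (2 ^ m * exp 1))" by simp
  fix N :: nat assume N: "1 \<le> N"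
  let ?A = "\<lambda>i. {n \<in> lattice (Suc m). idx_abs n \<le> N \<and> (\<forall>j<Suc m. n ! j \<le> n ! i)}"
  have cover: "\<exists>i<Suc m. n \<in> ?A i" if n: "n \<in> lattice (Suc m)" "idx_abs n \<le> N" for n
  proof -
    have "Max (nth n ` {..<Suc m}) \<in> nth n ` {..<Suc m}" by (intro Max_in) auto
    then obtain i where i: "i < Suc m" "n ! i = Max (nth n ` {..<Suc m})" by (auto simp: image_iff)
    have "n ! j \<le> n ! i" if "j < Suc m" for j
      unfolding i(2) using that by (intro Max_ge) auto
    thus ?thesis using n i by blast
  qed
  have finA: "finite (?A i)" for i
    by (rule finite_subset[OF _ finite_lattice_idx_abs_le[of "Suc m" N]]) auto
  have "(\<Sum>n | n \<in> lattice (Suc m) \<and> idx_abs n \<le> N. weight_fun \<alpha> (real (idx_abs n)))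
      \<le> (\<Sum>(i, n)\<in>(SIGMA i:{..<Suc m}. ?A i). weight_fun \<alpha> (real (idx_abs n)))"
    using cover
    by (intro sum_le_included[where i = snd] finite_lattice_idx_abs_le finite_SigmaI finA ballI)
      (fastforce intro: weight_fun_nonneg)+
  also have "\<dots> = (\<Sum>i<Suc m. \<Sum>n\<in>?A i. weight_fun \<alpha> (real (idx_abs n)))"
    using finA by (subst sum.Sigma) auto
  also have "\<dots> \<le> (\<Sum>i<Suc m. ?Y * (2 ^ m * exp 1 * (1 + moment_fun \<alpha> m (real N))))"
  proof (intro sum_mono)
    fix i assume i: "i \<in> {..<Suc m}"
    have "(\<Sum>n\<in>?A i. weight_fun \<alpha> (real (idx_abs n)))
        \<le> ?Y * (exp (logp (real N) powr \<alpha>) * (1 + logp (real N)) ^ m)"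
      using assms N i by (intro sum_weight_fun_lattice_max) auto
    also have "\<dots> \<le> ?Y * (2 ^ m * exp 1 * (1 + moment_fun \<alpha> m (real N)))"
      using Y assms by (intro mult_left_mono exp_powr_logp_le) auto
    finally show "(\<Sum>n\<in>?A i. weight_fun \<alpha> (real (idx_abs n)))
        \<le> ?Y * (2 ^ m * exp 1 * (1 + moment_fun \<alpha> m (real N)))" .
  qed
  finally show "(\<Sum>n | n \<in> lattice (Suc m) \<and> idx_abs n \<le> N. weight_fun \<alpha> (real (idx_abs n)))
    \<le> Suc m * (?Y * (2 ^ m * exp 1)) * (1 + moment_fun \<alpha> m (real N))"
    by (simp add: mult_ac)
qed

section \<open>Abel summation and comparison with the Choquet integral\<close>

lemma sum_by_parts_antimono_ge:
  fixes a v :: "nat \<Rightarrow> real"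
  assumes "\<And>M. 0 \<le> (\<Sum>m\<le>M. a m)" "antimono v" "\<And>m. 0 \<le> v m"
  shows "(\<Sum>m\<le>M. a m) * v M \<le> (\<Sum>m\<le>M. a m * v m)"
proof (induction M)
  case (Suc M)
  \<comment> \<open>Lowering the last value of \<open>v\<close> shrinks the product, because the
    partial sum is nonnegative.\<close>
  have "(\<Sum>m\<le>M. a m) * v (Suc M) \<le> (\<Sum>m\<le>M. a m) * v M"
    using assms by (intro mult_left_mono) (auto simp: antimono_def)
  thus ?case using Suc by (simp add: algebra_simps)
qed simp

text \<open>Between \<open>\<psi> m\<close> and \<open>\<psi> (Suc m)\<close> the function
  \<open>w\<close> is at least \<open>v (Suc m)\<close>, so the left side is a lower sum for its
  integral.\<close>

lemma sum_increments_le_integral: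
  fixes \<psi> v :: "nat \<Rightarrow> real" and w :: "real \<Rightarrow> real"
  assumes "set_integrable lborel {0..} w" "\<And>x. 0 \<le> w x" "mono \<psi>" "0 \<le> \<psi> 0"
    and "\<And>m x. x < \<psi> m \<Longrightarrow> v m \<le> w x"
  shows "(\<Sum>m<M. (\<psi> (Suc m) - \<psi> m) * v (Suc m)) \<le> (LBINT x:{0..}. w x)"
proof -
  have \<psi>0: "0 \<le> \<psi> m" for m using assms(3,4) by (metis monoD order_trans zero_le)
  have int: "set_integrable lborel {a..<b} w" if "0 \<le> a" for a b
    using that by (intro set_integrable_subset[OF assms(1)]) auto
  \<comment> \<open>Stopping the integral at \<open>\<psi> M\<close> lets the induction glue
    adjacent intervals.\<close>
  have "(\<Sum>m<M. (\<psi> (Suc m) - \<psi> m) * v (Suc m)) \<le> (LBINT x:{0..<\<psi> M}. w x)"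
  proof (induction M)
    case 0
    show ?case unfolding set_lebesgue_integral_def
      using assms(2) by (simp add: integral_nonneg_AE)
  next
    case (Suc M)
    have le: "\<psi> M \<le> \<psi> (Suc M)" using assms(3) by (simp add: monoD)
    have "(\<psi> (Suc M) - \<psi> M) * v (Suc M) = (LBINT x:{\<psi> M..<\<psi> (Suc M)}. v (Suc M))"
      using le by (simp add: set_lebesgue_integral_def)
    also have "\<dots> \<le> (LBINT x:{\<psi> M..<\<psi> (Suc M)}. w x)"
    proof (intro set_integral_mono int \<psi>0)
      show "set_integrable lborel {\<psi> M..<\<psi> (Suc M)} (\<lambda>x. v (Suc M))"
        unfolding set_integrable_def using le
        by (intro integrable_scaleR_left integrable_real_indicator) auto
    qed (use assms(5) in auto)
    also have "(LBINT x:{0..<\<psi> M}. w x) + \<dots> = (LBINT x:{0..<\<psi> M} \<union> {\<psi> M..<\<psi> (Suc M)}. w x)"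
      using \<psi>0 by (intro set_integral_Un[symmetric] int) auto
    also have "{0..<\<psi> M} \<union> {\<psi> M..<\<psi> (Suc M)} = {0..<\<psi> (Suc M)}"
      using le \<psi>0[of M] by auto
    finally show ?case using Suc by simp
  qed
  also have "\<dots> \<le> (LBINT x:{0..}. w x)"
    unfolding set_lebesgue_integral_def using assms(1,2) int[of 0 "\<psi> M"]
    by (intro integral_mono) (auto simp: set_integrable_def split: split_indicator)
  finally show ?thesis .
qed

text \<open>In the application \<open>v\<close> is the capacity tail of
  \<open>\<bar>X0\<bar>\<close> and \<open>w\<close> that of the moment function. The lattice
  estimate controls only partial sums of weights; as \<open>v\<close> decreases, Abel summation
  turns this into a comparison with increments of the moment function.\<close>

lemma sum_weight_fun_tail_bounded:
  fixes \<alpha> :: real and v :: "nat \<Rightarrow> real" and w :: "real \<Rightarrow> real"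
  assumes "1 < \<alpha>" and v: "antimono v" "\<And>m. 0 \<le> v m"
    and w: "set_integrable lborel {0..} w" "\<And>x. 0 \<le> w x"
    and vw: "\<And>m x. x < moment_fun \<alpha> p (real m) \<Longrightarrow> v m \<le> w x"
  shows "\<exists>C. \<forall>N. (\<Sum>n | n \<in> lattice (Suc p) \<and> idx_abs n \<le> N.
    weight_fun \<alpha> (real (idx_abs n)) * v (idx_abs n)) \<le> C"
proof -
  obtain C where C: "0 < C" "\<And>N. 1 \<le> N \<Longrightarrow>
      (\<Sum>n | n \<in> lattice (Suc p) \<and> idx_abs n \<le> N. weight_fun \<alpha> (real (idx_abs n)))
      \<le> C * (1 + moment_fun \<alpha> p (real N))"
    using sum_weight_fun_lattice[OF assms(1)] by blast
  define \<psi> where "\<psi> = (\<lambda>m. moment_fun \<alpha> p (real m))"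
  have mono: "mono \<psi>" unfolding \<psi>_def using assms(1) by (auto intro!: monoI moment_fun_mono)
  \<comment> \<open>Chosen so that its partial sums are \<open>C * (1 + \<psi> N)\<close>, the bound
    for those of the grouped weights \<open>g\<close>.\<close>
  define \<Phi> where "\<Phi> = (\<lambda>m. case m of 0 \<Rightarrow> C * (1 + \<psi> 0) | Suc m \<Rightarrow> C * (\<psi> (Suc m) - \<psi> m))"
  define L where "L = (\<lambda>N. {n \<in> lattice (Suc p). idx_abs n \<le> N})"
  define g where "g = (\<lambda>m. \<Sum>n | n \<in> lattice (Suc p) \<and> idx_abs n = m. weight_fun \<alpha> (real (idx_abs n)))"
  have finL: "finite (L N)" for N unfolding L_def by (rule finite_lattice_idx_abs_le)
  have group: "(\<Sum>n\<in>L N. weight_fun \<alpha> (real (idx_abs n)) * u (idx_abs n)) = (\<Sum>m\<le>N. g m * u m)"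
    for N and u :: "nat \<Rightarrow> real"
  proof -
    have "(\<Sum>n\<in>L N. weight_fun \<alpha> (real (idx_abs n)) * u (idx_abs n))
        = (\<Sum>m\<le>N. \<Sum>n | n \<in> L N \<and> idx_abs n = m. weight_fun \<alpha> (real (idx_abs n)) * u (idx_abs n))"
      using finL by (intro sum.group[symmetric]) (auto simp: L_def)
    also have "\<dots> = (\<Sum>m\<le>N. g m * u m)"
      unfolding g_def sum_distrib_right by (intro sum.cong) (auto simp: L_def)
    finally show ?thesis .
  qed
  have \<Phi>sum: "(\<Sum>m\<le>N. \<Phi> m) = C * (1 + \<psi> N)" for N
    by (induction N) (simp_all add: \<Phi>_def algebra_simps)
  have "0 \<le> (\<Sum>m\<le>N. \<Phi> m - g m)" for N
  proof (cases "N = 0")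
    case True
    \<comment> \<open>The lattice estimate starts at \<open>N = 1\<close>, so index 0 is treated
      apart; no lattice point has product 0.\<close>
    have "{n \<in> lattice (Suc p). idx_abs n = 0} = {}" using idx_abs_ge_1 by fastforce
    hence "g 0 = 0" unfolding g_def by (simp only: sum.empty)
    thus ?thesis using True C(1) by (simp add: \<Phi>_def \<psi>_def moment_fun_nonneg add_nonneg_nonneg)
  next
    case False
    thus ?thesis
      using C(2)[of N] group[of "\<lambda>_. 1" N] \<Phi>sum[of N] by (simp add: sum_subtractf L_def \<psi>_def)
  qed
  note D = this
  have "(\<Sum>m\<le>N. g m * v m) \<le> C * (1 + \<psi> 0) * v 0 + C * (LBINT x:{0..}. w x)" for N
  proof -
    have "0 \<le> (\<Sum>m\<le>N. \<Phi> m - g m) * v N" using D v by simp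
    also have "\<dots> \<le> (\<Sum>m\<le>N. (\<Phi> m - g m) * v m)"
      using D v by (intro sum_by_parts_antimono_ge) auto
    finally have "(\<Sum>m\<le>N. g m * v m) \<le> (\<Sum>m\<le>N. \<Phi> m * v m)"
      by (simp add: sum_subtractf algebra_simps)
    also have "\<dots> = C * (1 + \<psi> 0) * v 0 + C * (\<Sum>m<N. (\<psi> (Suc m) - \<psi> m) * v (Suc m))"
      by (induction N) (simp_all add: \<Phi>_def algebra_simps)
    also have "(\<Sum>m<N. (\<psi> (Suc m) - \<psi> m) * v (Suc m)) \<le> (LBINT x:{0..}. w x)"
      using w mono vw by (intro sum_increments_le_integral) (auto simp: \<psi>_def moment_fun_nonneg)
    finally show ?thesis using C by simp
  qed
  thus ?thesis using group[of v] unfolding L_def by metis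
qed

text \<open>Over the enclosing box the sum factors into the \<open>d\<close>-th power of a partial
  sum of a convergent one-dimensional series.\<close>

lemma sum_idx_abs_powr_bounded:
  fixes s :: real
  assumes "s < - 1"
  shows "\<exists>C. \<forall>N. (\<Sum>n | n \<in> lattice d \<and> idx_abs n \<le> N. real (idx_abs n) powr s) \<le> C"
proof (intro exI allI)
  fix N
  have sm: "summable (\<lambda>k. real k powr s)" using assms by (simp add: summable_real_powr_iff)
  have "(\<Sum>n | n \<in> lattice d \<and> idx_abs n \<le> N. real (idx_abs n) powr s)
      \<le> (\<Sum>n | set n \<subseteq> {1..N} \<and> length n = d. real (idx_abs n) powr s)"
    by (intro sum_mono2 finite_lists_length_eq lattice_idx_abs_le_subset) auto
  also have "\<dots> = (\<Sum>n | set n \<subseteq> {1..N} \<and> length n = d. prod_list (map (\<lambda>k. real k powr s) n))"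
  proof (rule sum.cong[OF refl])
    fix n :: "nat list"
    show "real (idx_abs n) powr s = prod_list (map (\<lambda>k. real k powr s) n)"
      by (induction n) (auto simp: idx_abs_def powr_mult)
  qed
  also have "\<dots> = (\<Sum>k\<in>{1..N}. real k powr s) ^ d"
    by (rule sum_prod_list_lists) simp
  also have "\<dots> \<le> (\<Sum>k. real k powr s) ^ d"
    by (intro power_mono sum_le_suminf sm) (auto intro: sum_nonneg)
  finally show "(\<Sum>n | n \<in> lattice d \<and> idx_abs n \<le> N. real (idx_abs n) powr s) \<le> (\<Sum>k. real k powr s) ^ d" .
qed

section \<open>Sub-linear expectations\<close>

lemma lLip_lipschitz:
  assumes "\<And>x y. (\<forall>i<n. x i = y i) \<Longrightarrow> \<phi> x = \<phi> y"
    and "\<And>x y. \<bar>\<phi> x - \<phi> y\<bar> \<le> K * (\<Sum>i<n. \<bar>x i - y i\<bar>)"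
  shows "lLip n \<phi>"
  unfolding lLip_def
\<comment> \<open>Exponent 0 turns the polynomial growth factor into the constant 3; the maximum
  keeps the constant positive.\<close>
proof (intro conjI allI impI exI[of _ "max 1 K"] exI[of _ "0 :: nat"])
  fix x y :: "nat \<Rightarrow> real"
  let ?S = "\<Sum>i<n. \<bar>x i - y i\<bar>"
  have "\<bar>\<phi> x - \<phi> y\<bar> \<le> K * ?S" by (rule assms(2))
  also have "\<dots> \<le> max 1 K * ?S" by (intro mult_right_mono sum_nonneg) auto
  also have "\<dots> \<le> max 1 K * 3 * ?S" by (intro mult_right_mono sum_nonneg) auto
  finally show "\<bar>\<phi> x - \<phi> y\<bar>
      \<le> max 1 K * (1 + (\<Sum>i<n. \<bar>x i\<bar>) ^ 0 + (\<Sum>i<n. \<bar>y i\<bar>) ^ 0) * ?S" by simp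
qed (use assms(1) in auto)

lemma lLip_one_lipschitz:
  fixes f :: "real \<Rightarrow> real"
  assumes "\<And>x y. \<bar>f x - f y\<bar> \<le> K * \<bar>x - y\<bar>"
  shows "lLip 1 (\<lambda>x. f (x 0))"
  by (rule lLip_lipschitz[of _ _ K]) (auto intro: assms)

text \<open>Layer cake: Fubini on the region \<open>0 \<le> x < Y \<omega>\<close>. The bound
  \<open>w\<close> will be a capacity tail, common to all measures of the family.\<close>

lemma (in prob_space) nn_integral_le_tail_integral:
  fixes Y :: "'a \<Rightarrow> real"
  assumes [measurable]: "Y \<in> borel_measurable M"
    and w: "set_integrable lborel {0..} w" "\<And>x. 0 \<le> x \<Longrightarrow> prob {\<omega> \<in> space M. x < Y \<omega>} \<le> w x"
  shows "(\<integral>\<^sup>+ \<omega>. ennreal (Y \<omega>) \<partial>M) \<le> ennreal (LBINT x:{0..}. w x)"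
proof -
  interpret L: pair_sigma_finite M lborel
    by (intro pair_sigma_finite.intro sigma_finite_measure_axioms sigma_finite_lborel)
  let ?i = "\<lambda>\<omega> x. indicator {(\<omega>, x). 0 \<le> x \<and> x < Y \<omega>} (\<omega>, x) :: ennreal"
  have "(\<integral>\<^sup>+ \<omega>. ennreal (Y \<omega>) \<partial>M) \<le> (\<integral>\<^sup>+ \<omega>. (\<integral>\<^sup>+ x. ?i \<omega> x \<partial>lborel) \<partial>M)"
  proof (intro nn_integral_mono)
    fix \<omega>
    have "(\<integral>\<^sup>+ x. ?i \<omega> x \<partial>lborel) = (\<integral>\<^sup>+ x. indicator {0..<Y \<omega>} x \<partial>lborel)"
      by (intro nn_integral_cong) (auto split: split_indicator)
    also have "\<dots> = emeasure lborel {0..<Y \<omega>}" by simp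
    finally show "ennreal (Y \<omega>) \<le> (\<integral>\<^sup>+ x. ?i \<omega> x \<partial>lborel)"
      by (cases "0 \<le> Y \<omega>") (auto simp: ennreal_neg)
  qed
  also have "\<dots> = (\<integral>\<^sup>+ x. (\<integral>\<^sup>+ \<omega>. ?i \<omega> x \<partial>M) \<partial>lborel)"
    by (rule L.Fubini'[symmetric]) measurable
  also have "\<dots> \<le> (\<integral>\<^sup>+ x. ennreal (indicator {0..} x *\<^sub>R w x) \<partial>lborel)"
  proof (intro nn_integral_mono)
    fix x :: real
    show "(\<integral>\<^sup>+ \<omega>. ?i \<omega> x \<partial>M) \<le> ennreal (indicator {0..} x *\<^sub>R w x)"
    proof (cases "0 \<le> x")
      case True
      have "(\<integral>\<^sup>+ \<omega>. ?i \<omega> x \<partial>M) = (\<integral>\<^sup>+ \<omega>. indicator {\<omega> \<in> space M. x < Y \<omega>} \<omega> \<partial>M)"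
        using True by (intro nn_integral_cong) (auto split: split_indicator)
      also have "\<dots> = emeasure M {\<omega> \<in> space M. x < Y \<omega>}" by simp
      also have "\<dots> \<le> ennreal (w x)"
        unfolding emeasure_eq_measure using w(2)[OF True] by (rule ennreal_leI)
      finally show ?thesis using True by simp
    qed simp
  qed
  also have "\<dots> = ennreal (LBINT x:{0..}. w x)"
    unfolding set_lebesgue_integral_def
  proof (rule nn_integral_eq_integral)
    show "integrable lborel (\<lambda>x. indicator {0..} x *\<^sub>R w x)"
      using w(1) by (simp add: set_integrable_def)
    have "0 \<le> w x" if "0 \<le> x" for x
      using w(2)[OF that] measure_nonneg order_trans by blast
    thus "AE x in lborel. 0 \<le> indicator {0..} x *\<^sub>R w x"
      by (auto split: split_indicator)
  qed
  finally show ?thesis .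
qed

locale sublinear_expectation =
  fixes M :: "'a measure" and Ps :: "'a measure set" and H :: "('a \<Rightarrow> real) set"
    and E :: "('a \<Rightarrow> real) \<Rightarrow> real"
  assumes sublinear: "sublinear_space M Ps H E"
begin

section \<open>Expectation and capacity through the representing measures\<close>

lemma
  shows H_comp: "set Xs \<subseteq> H \<Longrightarrow> lLip (length Xs) \<phi> \<Longrightarrow> (\<lambda>\<omega>. \<phi> (rv_vec Xs \<omega>)) \<in> H"
    and E_const: "E (\<lambda>_. c) = c"
    and E_scale: "Y \<in> H \<Longrightarrow> 0 < c \<Longrightarrow> E (\<lambda>\<omega>. c * Y \<omega>) = c * E Y"
    and Ps_nonempty: "Ps \<noteq> {}"
    and prob_space_Ps: "P \<in> Ps \<Longrightarrow> prob_space P"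
    and sets_Ps: "P \<in> Ps \<Longrightarrow> sets P = sets M"
    and integrable_H: "P \<in> Ps \<Longrightarrow> Y \<in> H \<Longrightarrow> integrable P Y"
    and E_bdd: "Y \<in> H \<Longrightarrow> bdd_above ((\<lambda>P. integral\<^sup>L P Y) ` Ps)"
    and E_eq_SUP: "Y \<in> H \<Longrightarrow> E Y = (SUP P\<in>Ps. integral\<^sup>L P Y)"
proof -
  note S = sublinear[unfolded sublinear_space_def]
  note S1 = S[THEN conjunct1] and S' = S[THEN conjunct2, THEN conjunct2]
  note S3 = S'[THEN conjunct1] and S4 = S'[THEN conjunct2, THEN conjunct1]
  note S7 = S'[THEN conjunct2, THEN conjunct2, THEN conjunct2, THEN conjunct2, THEN conjunct2]
  note S8 = S7[THEN conjunct2, THEN conjunct1] and S9 = S7[THEN conjunct2, THEN conjunct2]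
  show "set Xs \<subseteq> H \<Longrightarrow> lLip (length Xs) \<phi> \<Longrightarrow> (\<lambda>\<omega>. \<phi> (rv_vec Xs \<omega>)) \<in> H"
    using S1 by simp
  show "E (\<lambda>_. c) = c" using S3 by simp
  show "Y \<in> H \<Longrightarrow> 0 < c \<Longrightarrow> E (\<lambda>\<omega>. c * Y \<omega>) = c * E Y" using S4 by simp
  show "Ps \<noteq> {}" using S7[THEN conjunct1] .
  show "P \<in> Ps \<Longrightarrow> prob_space P" "P \<in> Ps \<Longrightarrow> sets P = sets M" using S8 by simp_all
  show "P \<in> Ps \<Longrightarrow> Y \<in> H \<Longrightarrow> integrable P Y" using S9 by simp
  show "Y \<in> H \<Longrightarrow> bdd_above ((\<lambda>P. integral\<^sup>L P Y) ` Ps)" using S9 by simp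
  show "Y \<in> H \<Longrightarrow> E Y = (SUP P\<in>Ps. integral\<^sup>L P Y)" using S9 by simp
qed

lemma space_Ps: "P \<in> Ps \<Longrightarrow> space P = space M"
  by (rule sets_eq_imp_space_eq[OF sets_Ps])

lemma measurable_H:
  assumes "Y \<in> H"
  shows "Y \<in> borel_measurable M"
proof -
  obtain P where P: "P \<in> Ps" using Ps_nonempty by blast
  show ?thesis
    using integrable_H[OF P assms] by (subst measurable_cong_sets[OF sets_Ps[OF P, symmetric] refl]) simp
qed

lemma integral_le_E: "P \<in> Ps \<Longrightarrow> Y \<in> H \<Longrightarrow> integral\<^sup>L P Y \<le> E Y"
  using E_eq_SUP E_bdd by (auto intro: cSUP_upper)

lemma E_le: "Y \<in> H \<Longrightarrow> (\<And>P. P \<in> Ps \<Longrightarrow> integral\<^sup>L P Y \<le> c) \<Longrightarrow> E Y \<le> c"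
  using E_eq_SUP Ps_nonempty by (auto intro: cSUP_least)

lemma E_nonneg:
  assumes "Y \<in> H" "\<And>\<omega>. 0 \<le> Y \<omega>"
  shows "0 \<le> E Y"
proof -
  obtain P where P: "P \<in> Ps" using Ps_nonempty by blast
  have "0 \<le> integral\<^sup>L P Y" using assms(2) by simp
  also have "\<dots> \<le> E Y" by (rule integral_le_E[OF P assms(1)])
  finally show ?thesis .
qed

lemma measure_le_cap:
  assumes "P \<in> Ps"
  shows "measure P A \<le> cap Ps A"
proof -
  have "bdd_above ((\<lambda>P. measure P A) ` Ps)"
    using prob_space.prob_le_1[OF prob_space_Ps] by (intro bdd_aboveI[of _ 1]) auto
  thus ?thesis unfolding cap_def using assms by (intro cSUP_upper)
qed

lemma cap_le: "(\<And>P. P \<in> Ps \<Longrightarrow> measure P A \<le> c) \<Longrightarrow> cap Ps A \<le> c"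
  unfolding cap_def using Ps_nonempty by (intro cSUP_least) auto

lemma cap_nonneg: "0 \<le> cap Ps A"
proof -
  obtain P where P: "P \<in> Ps" using Ps_nonempty by blast
  show ?thesis using order_trans[OF measure_nonneg measure_le_cap[OF P]] .
qed

lemma cap_mono:
  assumes "A \<subseteq> B" "B \<in> sets M"
  shows "cap Ps A \<le> cap Ps B"
proof (rule cap_le)
  fix P assume P: "P \<in> Ps"
  interpret prob_space P by (rule prob_space_Ps[OF P])
  have "measure P A \<le> measure P B"
    using assms sets_Ps[OF P] by (intro finite_measure_mono) auto
  thus "measure P A \<le> cap Ps B" using measure_le_cap[OF P, of B] by linarith
qed

lemma cap_Un_le:
  assumes "A \<in> sets M" "B \<in> sets M" "C \<subseteq> A \<union> B"
  shows "cap Ps C \<le> cap Ps A + cap Ps B"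
proof (rule cap_le)
  fix P assume P: "P \<in> Ps"
  interpret prob_space P by (rule prob_space_Ps[OF P])
  have "measure P C \<le> measure P (A \<union> B)"
    using assms sets_Ps[OF P] by (intro finite_measure_mono) auto
  also have "\<dots> \<le> measure P A + measure P B"
    using assms sets_Ps[OF P] by (intro measure_Un_le) auto
  finally show "measure P C \<le> cap Ps A + cap Ps B"
    using measure_le_cap[OF P, of A] measure_le_cap[OF P, of B] by linarith
qed

lemma cap_UN_le:
  assumes "finite I" "\<And>i. i \<in> I \<Longrightarrow> A i \<in> sets M"
  shows "cap Ps (\<Union>i\<in>I. A i) \<le> (\<Sum>i\<in>I. cap Ps (A i))"
proof (rule cap_le)
  fix P assume P: "P \<in> Ps"
  interpret prob_space P by (rule prob_space_Ps[OF P])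
  have "measure P (\<Union>i\<in>I. A i) \<le> (\<Sum>i\<in>I. measure P (A i))"
    using assms sets_Ps[OF P] by (intro finite_measure_subadditive_finite) auto
  also have "\<dots> \<le> (\<Sum>i\<in>I. cap Ps (A i))"
    by (intro sum_mono measure_le_cap P)
  finally show "measure P (\<Union>i\<in>I. A i) \<le> (\<Sum>i\<in>I. cap Ps (A i))" .
qed

text \<open>Markov's inequality, applied under each measure because the indicator of
  \<open>A\<close> need not belong to \<open>H\<close>.\<close>

lemma cap_le_E:
  assumes "Y \<in> H" "0 \<le> c" "A \<in> sets M" "\<And>\<omega>. 0 \<le> Y \<omega>" "\<And>\<omega>. \<omega> \<in> A \<Longrightarrow> 1 \<le> c * Y \<omega>"
  shows "cap Ps A \<le> c * E Y"
proof (rule cap_le)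
  fix P assume P: "P \<in> Ps"
  interpret prob_space P by (rule prob_space_Ps[OF P])
  have [measurable]: "A \<in> sets P" using assms sets_Ps[OF P] by simp
  have "integrable P (indicator A :: 'a \<Rightarrow> real)"
    by (intro integrable_real_indicator) (auto simp: emeasure_eq_measure)
  note int = this integrable_H[OF P]
  have "measure P A = (\<integral>\<omega>. indicator A \<omega> \<partial>P)" by simp
  also have "\<dots> \<le> (\<integral>\<omega>. c * Y \<omega> \<partial>P)"
    using assms int by (intro integral_mono) (auto split: split_indicator)
  also have "\<dots> \<le> c * E Y"
    using assms integral_le_E[OF P] by (auto intro: mult_left_mono)
  finally show "measure P A \<le> c * E Y" .
qed

lemma E_le_cap:
  assumes "Y \<in> H" "A \<in> sets M" "\<And>\<omega>. \<omega> \<in> space M \<Longrightarrow> Y \<omega> \<le> indicator A \<omega>"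
  shows "E Y \<le> cap Ps A"
proof (rule E_le[OF assms(1)])
  fix P assume P: "P \<in> Ps"
  interpret prob_space P by (rule prob_space_Ps[OF P])
  have [measurable]: "A \<in> sets P" using assms sets_Ps[OF P] by simp
  have "integrable P (indicator A :: 'a \<Rightarrow> real)"
    by (intro integrable_real_indicator) (auto simp: emeasure_eq_measure)
  note int = this integrable_H[OF P]
  have "integral\<^sup>L P Y \<le> (\<integral>\<omega>. indicator A \<omega> \<partial>P)"
    using assms int space_Ps[OF P] by (intro integral_mono) auto
  also have "\<dots> = measure P A" by simp
  also have "\<dots> \<le> cap Ps A" by (rule measure_le_cap[OF P])
  finally show "integral\<^sup>L P Y \<le> cap Ps A" .
qed

section \<open>Identical distribution and independence through Lipschitz test functions\<close>

lemma H_lipschitz: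
  assumes "Y \<in> H" "\<And>x y. \<bar>f x - f y\<bar> \<le> K * \<bar>x - y\<bar>"
  shows "(\<lambda>\<omega>. f (Y \<omega>)) \<in> H"
  using H_comp[of "[Y]" "\<lambda>x. f (x 0)"] lLip_one_lipschitz[of f, OF assms(2)] assms(1)
  by (simp add: rv_vec_def)

lemma E_ident:
  assumes "sl_ident E Y Z" "\<And>x y. \<bar>f x - f y\<bar> \<le> K * \<bar>x - y\<bar>"
  shows "E (\<lambda>\<omega>. f (Y \<omega>)) = E (\<lambda>\<omega>. f (Z \<omega>))"
  using assms(1) lLip_one_lipschitz[of f, OF assms(2)] unfolding sl_ident_def
  by (auto simp: rv_vec_def dest!: spec[of _ "\<lambda>x. f (x 0)"])

text \<open>Identically distributed variables need not have equal upper tail probabilities, because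
  indicators are not admissible test functions; the loss is an arbitrarily small shift.\<close>

lemma cap_abs_tail_ident:
  assumes "sl_ident E Y Z" "Y \<in> H" "Z \<in> H" "a < b"
  shows "cap Ps {\<omega> \<in> space M. b < \<bar>Y \<omega>\<bar>} \<le> cap Ps {\<omega> \<in> space M. a < \<bar>Z \<omega>\<bar>}"
proof -
  \<comment> \<open>A ramp lying between the indicators of \<open>b < \<bar>x\<bar>\<close> and
    \<open>a < \<bar>x\<bar>\<close>, with Lipschitz constant \<open>1 / (b - a)\<close>.\<close>
  define f where "f = (\<lambda>x. max 0 (min 1 ((\<bar>x\<bar> - a) / (b - a))))"
  have [measurable]: "Y \<in> borel_measurable M" "Z \<in> borel_measurable M"
    using assms measurable_H by auto
  have lip: "\<bar>f x - f y\<bar> \<le> 1 / (b - a) * \<bar>x - y\<bar>" for x y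
  proof -
    have "\<bar>f x - f y\<bar> \<le> \<bar>(\<bar>x\<bar> - a) / (b - a) - (\<bar>y\<bar> - a) / (b - a)\<bar>"
      unfolding f_def by linarith
    also have "\<dots> = 1 / (b - a) * \<bar>\<bar>x\<bar> - \<bar>y\<bar>\<bar>"
      using assms(4) by (simp flip: diff_divide_distrib)
    also have "\<dots> \<le> 1 / (b - a) * \<bar>x - y\<bar>"
      using assms(4) by (intro mult_left_mono) auto
    finally show ?thesis .
  qed
  have "cap Ps {\<omega> \<in> space M. b < \<bar>Y \<omega>\<bar>} \<le> 1 * E (\<lambda>\<omega>. f (Y \<omega>))"
    using assms by (intro cap_le_E H_lipschitz[OF _ lip]) (auto simp: f_def)
  also have "\<dots> = E (\<lambda>\<omega>. f (Z \<omega>))"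
    using E_ident[of Y Z f, OF assms(1) lip] by simp
  also have "\<dots> \<le> cap Ps {\<omega> \<in> space M. a < \<bar>Z \<omega>\<bar>}"
    using assms by (intro E_le_cap H_lipschitz[OF _ lip])
      (auto simp: f_def divide_nonpos_pos split: split_indicator)
  finally show ?thesis .
qed

text \<open>Factors bounded by 1 keep the product globally Lipschitz, hence admissible for
  independence, which peels off the last factor. Positivity of the factors lets the others leave the
  inner expectation by positive homogeneity.\<close>

lemma E_prod_indep:
  fixes Z :: "nat \<Rightarrow> 'a \<Rightarrow> real" and g :: "nat \<Rightarrow> real \<Rightarrow> real"
  assumes Z: "\<And>n. Z n \<in> H" and indep: "\<And>n. sl_indep E (Z n) (map Z [0..<n])"
    and g: "\<And>n x. 0 < g n x" "\<And>n x. g n x \<le> 1"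
    and lip: "\<And>n x y. \<bar>g n x - g n y\<bar> \<le> K * \<bar>x - y\<bar>"
  shows "(\<lambda>\<omega>. \<Prod>j<n. g j (Z j \<omega>)) \<in> H"
    and "E (\<lambda>\<omega>. \<Prod>j<n. g j (Z j \<omega>)) = (\<Prod>j<n. E (\<lambda>\<omega>. g j (Z j \<omega>)))"
proof -
  define \<psi> where "\<psi> = (\<lambda>n x. \<Prod>j<n. g j (x j :: real))"
  have lL: "lLip n (\<psi> n)" for n
  proof (rule lLip_lipschitz[of _ _ K])
    fix x y :: "nat \<Rightarrow> real"
    have "\<bar>\<psi> n x - \<psi> n y\<bar> \<le> (\<Sum>j<n. \<bar>g j (x j) - g j (y j)\<bar>)"
      unfolding \<psi>_def real_norm_def[symmetric] using g
      by (intro norm_prod_diff) (auto simp: less_imp_le abs_of_pos)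
    also have "\<dots> \<le> K * (\<Sum>j<n. \<bar>x j - y j\<bar>)"
      unfolding sum_distrib_left by (intro sum_mono lip)
    finally show "\<bar>\<psi> n x - \<psi> n y\<bar> \<le> K * (\<Sum>j<n. \<bar>x j - y j\<bar>)" .
  qed (simp add: \<psi>_def)
  have vec: "\<psi> n (rv_vec (map Z [0..<n]) \<omega>) = (\<Prod>j<n. g j (Z j \<omega>))" for n \<omega>
    by (simp add: \<psi>_def rv_vec_def)
  have inH: "(\<lambda>\<omega>. \<Prod>j<n. g j (Z j \<omega>)) \<in> H" for n
    using H_comp[of "map Z [0..<n]" "\<psi> n"] lL[of n] Z by (auto simp: vec)
  show "(\<lambda>\<omega>. \<Prod>j<n. g j (Z j \<omega>)) \<in> H" by (rule inH)
  have g_inH: "(\<lambda>\<omega>. g n (Z n \<omega>)) \<in> H" for n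
    by (rule H_lipschitz[OF Z lip])
  show "E (\<lambda>\<omega>. \<Prod>j<n. g j (Z j \<omega>)) = (\<Prod>j<n. E (\<lambda>\<omega>. g j (Z j \<omega>)))"
  proof (induction n)
    case 0
    show ?case by (simp add: E_const)
  next
    case (Suc n)
    define e where "e = E (\<lambda>\<omega>. g n (Z n \<omega>))"
    have e0: "0 \<le> e" unfolding e_def by (intro E_nonneg g_inH) (simp add: g less_imp_le)
    have "E (\<lambda>\<omega>. \<Prod>j<Suc n. g j (Z j \<omega>))
        = E (\<lambda>\<omega>. \<psi> (Suc n) (rv_vec (map Z [0..<n] @ [Z n]) \<omega>))"
      using vec[of "Suc n"] by simp
    also have "\<dots> = E (\<lambda>\<omega>. E (\<lambda>\<omega>'. \<psi> (Suc n) ((rv_vec (map Z [0..<n]) \<omega>)(n := Z n \<omega>'))))"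
      using indep[of n] lL[of "Suc n"] by (simp add: sl_indep_def)
    also have "\<dots> = E (\<lambda>\<omega>. E (\<lambda>\<omega>'. (\<Prod>j<n. g j (Z j \<omega>)) * g n (Z n \<omega>')))"
      by (simp add: \<psi>_def rv_vec_def)
    also have "\<dots> = E (\<lambda>\<omega>. e * (\<Prod>j<n. g j (Z j \<omega>)))"
      by (subst E_scale[OF g_inH]) (auto simp: e_def g mult.commute intro: prod_pos)
    \<comment> \<open>Homogeneity covers positive constants only; for \<open>e = 0\<close> both
      sides are 0.\<close>
    also have "\<dots> = e * E (\<lambda>\<omega>. \<Prod>j<n. g j (Z j \<omega>))"
      using e0 E_scale[OF inH, of e n] E_const[of 0] by (cases "e = 0") auto
    finally show ?case using Suc by (simp add: e_def)
  qed
qed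

text \<open>Independence holds along an enumeration in which \<open>A\<close> may occupy scattered
  positions. The product is extended to an initial segment, with the constant factor 1, of
  expectation 1, at positions outside \<open>A\<close>.\<close>

lemma E_prod_field:
  fixes f :: "real \<Rightarrow> real"
  assumes X: "\<And>k. k \<in> lattice d \<Longrightarrow> X k \<in> H" "sl_indep_field E d X"
    and ident: "\<And>k. k \<in> lattice d \<Longrightarrow> sl_ident E (X k) X0"
    and f: "\<And>x. 0 < f x" "\<And>x. f x \<le> 1" "\<And>x y. \<bar>f x - f y\<bar> \<le> K * \<bar>x - y\<bar>"
    and A: "finite A" "A \<subseteq> lattice d"
  shows "(\<lambda>\<omega>. \<Prod>k\<in>A. f (X k \<omega>)) \<in> H"
    and "E (\<lambda>\<omega>. \<Prod>k\<in>A. f (X k \<omega>)) = E (\<lambda>\<omega>. f (X0 \<omega>)) ^ card A"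
proof -
  obtain en where en: "bij_betw en UNIV (lattice d)"
      "\<And>n. sl_indep E (X (en n)) (map (\<lambda>j. X (en j)) [0..<n])"
    using X(2) unfolding sl_indep_field_def by blast
  have en_lat: "en n \<in> lattice d" for n using en(1) by (auto simp: bij_betw_def)
  have "inj en" using en(1) by (auto simp: bij_betw_def)
  define J where "J = en -` A"
  have AJ: "A = en ` J" unfolding J_def using A en(1) by (auto simp: bij_betw_def)
  have finJ: "finite J" unfolding J_def using A \<open>inj en\<close> by (intro finite_vimageI) 
  then obtain n where n: "J \<subseteq> {..<n}" using finite_nat_bounded by blast
  define g where "g = (\<lambda>j x. if j \<in> J then f x else 1)"
  have K: "0 \<le> K" using f(3)[of 0 1] by simp
  have restrict: "(\<Prod>k\<in>A. h (en' k)) = (\<Prod>j<n. if j \<in> J then h j else 1)"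
    if "\<And>j. en' (en j) = j" for h :: "nat \<Rightarrow> real" and en'
    using n \<open>inj en\<close> finJ that
    by (simp add: AJ prod.reindex inj_on_subset[OF \<open>inj en\<close>] flip: prod.inter_restrict) (simp add: Int_absorb1)
  have inv: "inv en (en j) = j" for j using \<open>inj en\<close> by (rule inv_f_f)
  have en_inv: "en (inv en k) = k" if "k \<in> A" for k using that AJ inv by auto
  have eq: "(\<Prod>k\<in>A. f (X k \<omega>)) = (\<Prod>j<n. g j (X (en j) \<omega>))" for \<omega>
  proof -
    have "(\<Prod>k\<in>A. f (X k \<omega>)) = (\<Prod>k\<in>A. f (X (en (inv en k)) \<omega>))"
      by (intro prod.cong) (auto simp: en_inv)
    also have "\<dots> = (\<Prod>j<n. g j (X (en j) \<omega>))"
      by (subst restrict[OF inv, of "\<lambda>j. f (X (en j) \<omega>)"]) (simp add: g_def)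
    finally show ?thesis .
  qed
  have g: "0 < g j x" "g j x \<le> 1" "\<bar>g j x - g j y\<bar> \<le> K * \<bar>x - y\<bar>" for j x y
    using f K by (auto simp: g_def)
  note prod = E_prod_indep[of "\<lambda>j. X (en j)" g K n, OF X(1)[OF en_lat] en(2) g]
  show "(\<lambda>\<omega>. \<Prod>k\<in>A. f (X k \<omega>)) \<in> H" using prod(1) by (simp add: eq)
  have "E (\<lambda>\<omega>. \<Prod>k\<in>A. f (X k \<omega>)) = (\<Prod>j<n. E (\<lambda>\<omega>. g j (X (en j) \<omega>)))"
    using prod(2) by (simp add: eq)
  also have "\<dots> = (\<Prod>j<n. if j \<in> J then E (\<lambda>\<omega>. f (X0 \<omega>)) else 1)"
    using E_ident[of _ X0 f, OF ident[OF en_lat] f(3)]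
    by (intro prod.cong) (auto simp: g_def E_const)
  also have "\<dots> = E (\<lambda>\<omega>. f (X0 \<omega>)) ^ card A"
    by (subst restrict[OF inv, symmetric]) simp
  finally show "E (\<lambda>\<omega>. \<Prod>k\<in>A. f (X k \<omega>)) = E (\<lambda>\<omega>. f (X0 \<omega>)) ^ card A" .
qed

end

section \<open>Tail estimate for partial sums\<close>

lemma exp_lipschitz_nonpos:
  fixes u v :: real
  assumes "u \<le> 0" "v \<le> 0"
  shows "\<bar>exp u - exp v\<bar> \<le> \<bar>u - v\<bar>"
proof -
  have *: "exp v - exp u \<le> v - u" if "u \<le> v" "v \<le> 0" for u v :: real
  proof -
    define e where "e = exp (u - v)"
    have "1 + (u - v) \<le> e" unfolding e_def by (rule exp_ge_add_one_self)
    hence e: "1 - e \<le> v - u" by (simp add: algebra_simps)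
    have "exp v - exp u = exp v * (1 - e)" by (simp add: e_def exp_diff field_simps)
    also have "\<dots> \<le> 1 * (1 - e)"
      using that by (intro mult_right_mono) (auto simp: e_def)
    finally show ?thesis using e by simp
  qed
  show ?thesis
  proof (cases "u \<le> v")
    case True
    thus ?thesis using *[of u v] assms by simp
  next
    case False
    thus ?thesis using *[of v u] assms by simp
  qed
qed

lemma measurable_logp [measurable]: "logp \<in> borel_measurable borel"
  unfolding logp_def[abs_def] by measurable

text \<open>The Chebyshev exponent at truncation level \<open>b\<close>: \<theta> times the slope of
  the chord from the origin to the graph of \<open>(ln t) powr \<alpha>\<close> at
  \<open>b\<close>.\<close>

definition slope :: "real \<Rightarrow> real \<Rightarrow> real \<Rightarrow> real" where
  "slope \<theta> \<alpha> b = \<theta> * ln b powr \<alpha> / b"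

text \<open>For \<open>l \<ge> 0\<close> the shift by \<open>b\<close> keeps the values in
  \<open>(0, 1]\<close> and the function globally Lipschitz, as the product rule requires. The sign
  \<open>s\<close> selects the upper or the lower tail.\<close>

definition trunc_exp :: "real \<Rightarrow> real \<Rightarrow> real \<Rightarrow> real \<Rightarrow> real" where
  "trunc_exp s l b x = exp (l * (min (s * x) b - b))"

lemma trunc_exp_lipschitz:
  assumes "0 \<le> l" "\<bar>s\<bar> = 1"
  shows "\<bar>trunc_exp s l b x - trunc_exp s l b y\<bar> \<le> l * \<bar>x - y\<bar>"
proof -
  have "\<bar>trunc_exp s l b x - trunc_exp s l b y\<bar>
      \<le> \<bar>l * (min (s * x) b - b) - l * (min (s * y) b - b)\<bar>"
    unfolding trunc_exp_def using assms
    by (intro exp_lipschitz_nonpos) (auto simp: mult_nonneg_nonpos)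
  also have "\<dots> = l * \<bar>min (s * x) b - min (s * y) b\<bar>"
    using assms by (simp add: abs_mult flip: right_diff_distrib)
  also have "\<dots> \<le> l * \<bar>s * x - s * y\<bar>"
    using assms by (intro mult_left_mono) auto
  also have "\<bar>s * x - s * y\<bar> = \<bar>x - y\<bar>"
    using assms by (simp add: abs_mult flip: right_diff_distrib)
  finally show ?thesis .
qed

context sublinear_expectation
begin

text \<open>The moment function of \<open>X0\<close> need not belong to \<open>H\<close>, so
  \<open>E\<close> is not applied to it; instead its mean is bounded uniformly over the
  measures.\<close>

lemma integral_moment_fun_le:
  assumes P: "P \<in> Ps" and X0: "X0 \<in> H"
    and moment: "set_integrable lborel {0..}
      (\<lambda>x. cap Ps {\<omega>\<in>space M. moment_fun \<alpha> m \<bar>X0 \<omega>\<bar> > x})"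
  shows "integrable P (\<lambda>\<omega>. moment_fun \<alpha> m \<bar>X0 \<omega>\<bar>)"
    and "(\<integral>\<omega>. moment_fun \<alpha> m \<bar>X0 \<omega>\<bar> \<partial>P)
      \<le> (LBINT x:{0..}. cap Ps {\<omega>\<in>space M. moment_fun \<alpha> m \<bar>X0 \<omega>\<bar> > x})"
proof -
  interpret prob_space P by (rule prob_space_Ps[OF P])
  have [measurable]: "X0 \<in> borel_measurable P" using integrable_H[OF P X0] by simp
  have meas: "(\<lambda>\<omega>. moment_fun \<alpha> m \<bar>X0 \<omega>\<bar>) \<in> borel_measurable P"
    unfolding moment_fun_def by measurable
  have nn: "(\<integral>\<^sup>+ \<omega>. ennreal (moment_fun \<alpha> m \<bar>X0 \<omega>\<bar>) \<partial>P)
      \<le> ennreal (LBINT x:{0..}. cap Ps {\<omega>\<in>space M. moment_fun \<alpha> m \<bar>X0 \<omega>\<bar> > x})"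
    using measure_le_cap[OF P] space_Ps[OF P]
    by (intro nn_integral_le_tail_integral meas moment) auto
  show "integrable P (\<lambda>\<omega>. moment_fun \<alpha> m \<bar>X0 \<omega>\<bar>)"
    by (rule integrableI_nonneg[OF meas]) (use nn in \<open>auto simp: moment_fun_nonneg intro: le_less_trans\<close>)
  show "(\<integral>\<omega>. moment_fun \<alpha> m \<bar>X0 \<omega>\<bar> \<partial>P)
      \<le> (LBINT x:{0..}. cap Ps {\<omega>\<in>space M. moment_fun \<alpha> m \<bar>X0 \<omega>\<bar> > x})"
    using nn unfolding set_lebesgue_integral_def
    by (intro integral_real_bounded Bochner_Integration.integral_nonneg) (auto simp: cap_nonneg)
qed

text \<open>The linear term of the expansion has mean zero under every measure, and the chord bound
  controls the remainder by the moment function. The point is that \<open>D\<close> is independent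
  of \<open>b\<close>.\<close>

lemma E_trunc_exp_le:
  assumes X0: "X0 \<in> H" "E X0 = 0" "E (\<lambda>\<omega>. - X0 \<omega>) = 0"
    and \<alpha>: "1 < \<alpha>" and \<theta>: "0 \<le> \<theta>" "\<theta> < 1" and s: "\<bar>s\<bar> = 1"
    and moment: "set_integrable lborel {0..}
      (\<lambda>x. cap Ps {\<omega>\<in>space M. moment_fun \<alpha> m \<bar>X0 \<omega>\<bar> > x})"
  shows "\<exists>D\<ge>0. \<forall>b>1. E (\<lambda>\<omega>. trunc_exp s (slope \<theta> \<alpha> b) b (X0 \<omega>))
    \<le> exp (- (slope \<theta> \<alpha> b * b)) * (1 + (slope \<theta> \<alpha> b)\<^sup>2 * D)"
proof -
  define \<Psi> where "\<Psi> = (\<lambda>\<omega>. moment_fun \<alpha> m \<bar>X0 \<omega>\<bar>)"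
  define I where "I = (LBINT x:{0..}. cap Ps {\<omega>\<in>space M. \<Psi> \<omega> > x})"
  have I0: "0 \<le> I"
    unfolding I_def set_lebesgue_integral_def by (intro Bochner_Integration.integral_nonneg) (auto simp: cap_nonneg)
  obtain K where K: "0 < K"
      "\<And>x. x\<^sup>2 * exp (\<theta> * logp \<bar>x\<bar> powr \<alpha>) \<le> K * (1 + moment_fun \<alpha> m \<bar>x\<bar>)"
    using square_exp_le_moment_fun[OF \<theta>(2) \<alpha>] by blast
  define C where "C = exp (\<alpha> powr \<alpha> * exp \<alpha>) * K"
  have C0: "0 \<le> C" using K by (simp add: C_def)
  have negX: "(\<lambda>\<omega>. - X0 \<omega>) \<in> H"
    by (rule H_lipschitz[OF X0(1), of uminus 1]) simp
  show ?thesis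
  proof (intro exI[of _ "C * (1 + I)"] conjI allI impI)
    show "0 \<le> C * (1 + I)" using C0 I0 by simp
    fix b :: real assume b: "1 < b"
    define l where "l = slope \<theta> \<alpha> b"
    have l: "0 \<le> l" using b \<theta> by (simp add: l_def slope_def)
    have fH: "(\<lambda>\<omega>. trunc_exp s l b (X0 \<omega>)) \<in> H"
      by (rule H_lipschitz[OF X0(1) trunc_exp_lipschitz[OF l s]])
    have pw: "trunc_exp s l b x
        \<le> exp (- (l * b)) * (1 + l * (s * x) + l\<^sup>2 * (C * (1 + moment_fun \<alpha> m \<bar>x\<bar>)))" for x
    proof -
      have abs: "\<bar>s * x\<bar> = \<bar>x\<bar>" using s by (simp add: abs_mult)
      have sq: "(s * x)\<^sup>2 = x\<^sup>2" using abs by (metis power2_abs)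
      have "l * min (abs x) b \<le> \<alpha> powr \<alpha> * exp \<alpha> + \<theta> * logp \<bar>x\<bar> powr \<alpha>"
        unfolding l_def slope_def using \<theta> \<alpha> b by (intro chord_le_logp_powr) auto
      hence "x\<^sup>2 * exp (l * min (abs x) b) \<le> x\<^sup>2 * exp (\<alpha> powr \<alpha> * exp \<alpha> + \<theta> * logp \<bar>x\<bar> powr \<alpha>)"
        by (intro mult_left_mono) auto
      also have "\<dots> = exp (\<alpha> powr \<alpha> * exp \<alpha>) * (x\<^sup>2 * exp (\<theta> * logp \<bar>x\<bar> powr \<alpha>))"
        by (simp add: exp_add)
      also have "\<dots> \<le> exp (\<alpha> powr \<alpha> * exp \<alpha>) * (K * (1 + moment_fun \<alpha> m \<bar>x\<bar>))"
        by (intro mult_left_mono K(2)) auto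
      finally have "x\<^sup>2 * exp (l * min (abs x) b) \<le> C * (1 + moment_fun \<alpha> m \<bar>x\<bar>)"
        by (simp add: C_def)
      hence "l\<^sup>2 * (x\<^sup>2 * exp (l * min (abs x) b)) \<le> l\<^sup>2 * (C * (1 + moment_fun \<alpha> m \<bar>x\<bar>))"
        by (intro mult_left_mono) auto
      moreover have "exp (l * min (s * x) b) \<le> 1 + l * (s * x) + l\<^sup>2 * (x\<^sup>2 * exp (l * min (abs x) b))"
        using exp_min_le[of l b "s * x"] l b by (simp only: abs sq)
      ultimately have "exp (l * min (s * x) b)
          \<le> 1 + l * (s * x) + l\<^sup>2 * (C * (1 + moment_fun \<alpha> m \<bar>x\<bar>))" by linarith
      moreover have "trunc_exp s l b x = exp (- (l * b)) * exp (l * min (s * x) b)"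
        by (simp add: trunc_exp_def right_diff_distrib flip: exp_add)
      ultimately show ?thesis by (simp only: mult_left_mono exp_ge_zero)
    qed
    have "E (\<lambda>\<omega>. trunc_exp s l b (X0 \<omega>)) \<le> exp (- (l * b)) * (1 + l\<^sup>2 * (C * (1 + I)))"
    proof (rule E_le[OF fH])
      fix P assume P: "P \<in> Ps"
      interpret prob_space P by (rule prob_space_Ps[OF P])
      note int = integrable_H[OF P X0(1)]
      have mom: "integrable P \<Psi>" "integral\<^sup>L P \<Psi> \<le> I"
        using integral_moment_fun_le[OF P X0(1) moment] by (simp_all add: \<Psi>_def I_def)
      \<comment> \<open>The vanishing of both expectations forces mean zero under each single
        measure.\<close>
      have "integral\<^sup>L P X0 \<le> 0" "integral\<^sup>L P (\<lambda>\<omega>. - X0 \<omega>) \<le> 0"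
        using integral_le_E[OF P] X0 negX by metis+
      hence zero: "integral\<^sup>L P X0 = 0" by simp
      have "(\<integral>\<omega>. trunc_exp s l b (X0 \<omega>) \<partial>P)
          \<le> (\<integral>\<omega>. exp (- (l * b)) * (1 + l * (s * X0 \<omega>) + l\<^sup>2 * (C * (1 + \<Psi> \<omega>))) \<partial>P)"
        using integrable_H[OF P fH] int mom pw by (intro integral_mono) (auto simp: \<Psi>_def)
      also have "\<dots> = exp (- (l * b)) * (1 + l\<^sup>2 * (C * (1 + integral\<^sup>L P \<Psi>)))"
        using int mom zero by (simp add: prob_space)
      also have "\<dots> \<le> exp (- (l * b)) * (1 + l\<^sup>2 * (C * (1 + I)))"
        using mom C0 by (intro mult_left_mono add_mono) auto
      finally show "(\<integral>\<omega>. trunc_exp s l b (X0 \<omega>) \<partial>P) \<le> exp (- (l * b)) * (1 + l\<^sup>2 * (C * (1 + I)))" .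
    qed
    thus "E (\<lambda>\<omega>. trunc_exp s (slope \<theta> \<alpha> b) b (X0 \<omega>))
        \<le> exp (- (slope \<theta> \<alpha> b * b)) * (1 + (slope \<theta> \<alpha> b)\<^sup>2 * (C * (1 + I)))"
      by (simp add: l_def)
  qed
qed

section \<open>Exponential Chebyshev bound for one tail of a partial sum\<close>

lemma cap_partial_sum_one_sided_le:
  assumes X0: "X0 \<in> H" "E X0 = 0" "E (\<lambda>\<omega>. - X0 \<omega>) = 0"
    and X: "\<And>k. k \<in> lattice d \<Longrightarrow> X k \<in> H" "sl_indep_field E d X"
    and ident: "\<And>k. k \<in> lattice d \<Longrightarrow> sl_ident E (X k) X0"
    and \<alpha>: "1 < \<alpha>" and \<epsilon>: "1 < \<epsilon>" and s: "\<bar>s\<bar> = 1"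
    and moment: "set_integrable lborel {0..}
      (\<lambda>x. cap Ps {\<omega>\<in>space M. moment_fun \<alpha> m \<bar>X0 \<omega>\<bar> > x})"
  shows "\<exists>K\<ge>0. \<forall>n\<in>lattice d.
    cap Ps {\<omega>\<in>space M. real (idx_abs n) * \<epsilon> < s * partial_sum d X n \<omega>}
    \<le> real (idx_abs n) * cap Ps {\<omega>\<in>space M. real (idx_abs n) < \<bar>X0 \<omega>\<bar>}
      + K * exp (- (logp (real (idx_abs n)) powr \<alpha>))"
proof -
  \<comment> \<open>The excess of \<epsilon> over 1 is spent twice: one factor \<open>c\<close>
    lifts the truncation level strictly above \<open>N\<close>, as the comparison of tails needs,
    the other makes \<theta> smaller than 1.\<close>
  define c where "c = sqrt \<epsilon>"
  define \<theta> where "\<theta> = 1 / c"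
  have c: "1 < c" "c * c = \<epsilon>" using \<epsilon> by (auto simp: c_def)
  have \<theta>: "0 \<le> \<theta>" "\<theta> < 1" using c by (auto simp: \<theta>_def)
  obtain D where D: "0 \<le> D" "\<And>b. 1 < b \<Longrightarrow> E (\<lambda>\<omega>. trunc_exp s (slope \<theta> \<alpha> b) b (X0 \<omega>))
      \<le> exp (- (slope \<theta> \<alpha> b * b)) * (1 + (slope \<theta> \<alpha> b)\<^sup>2 * D)"
    using E_trunc_exp_le[OF X0 \<alpha> \<theta> s moment] by blast
  have [measurable]: "X0 \<in> borel_measurable M" by (rule measurable_H[OF X0(1)])
  show ?thesis
  \<comment> \<open>The second order terms of the \<open>N\<close> factors add up to
    \<open>D * N * l\<^sup>2\<close>, and \<open>N * l\<^sup>2\<close> is at most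
    \<open>ln b powr (2 * \<alpha>) / b\<close>, which is bounded by
    \<open>(2 * \<alpha>) powr (2 * \<alpha>)\<close>.\<close>
  proof (intro exI[of _ "exp (D * (2 * \<alpha>) powr (2 * \<alpha>))"] conjI ballI)
    fix n assume n: "n \<in> lattice d"
    define N where "N = real (idx_abs n)"
    define A where "A = {k \<in> lattice d. idx_le k n}"
    have A: "finite A" "A \<subseteq> lattice d" "card A = idx_abs n"
      using card_idx_le[OF n] by (auto simp: A_def)
    have N1: "1 \<le> N" using idx_abs_ge_1[OF n] by (simp add: N_def)
    define b where "b = c * N"
    have b: "1 < b" "N < b" using c N1 by (auto simp: b_def less_1_mult' mult_less_cancel_right1
        intro: less_le_trans[of 1 c])
    define l where "l = slope \<theta> \<alpha> b"
    have l: "0 \<le> l" using b \<theta> by (simp add: l_def slope_def)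
    have [measurable]: "X k \<in> borel_measurable M" if "k \<in> A" for k
      using X(1) A(2) that measurable_H by blast
    have S_meas [measurable]: "(\<lambda>\<omega>. \<Sum>k\<in>A. u (X k \<omega>)) \<in> borel_measurable M"
      if [measurable]: "u \<in> borel_measurable borel" for u :: "real \<Rightarrow> real"
      by (intro borel_measurable_sum) measurable
    let ?T = "{\<omega>\<in>space M. N * \<epsilon> < (\<Sum>k\<in>A. min (s * X k \<omega>) b)}"
    let ?J = "\<Union>k\<in>A. {\<omega>\<in>space M. b < s * X k \<omega>}"
    have T_meas: "?T \<in> sets M" using S_meas[of "\<lambda>x. min (s * x) b"] by measurable
    have J_meas: "?J \<in> sets M" using A by (intro sets.finite_UN) auto
    have sub: "{\<omega>\<in>space M. N * \<epsilon> < s * partial_sum d X n \<omega>} \<subseteq> ?T \<union> ?J"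
    proof (rule subsetI, rule ccontr)
      fix \<omega> assume \<omega>: "\<omega> \<in> {\<omega>\<in>space M. N * \<epsilon> < s * partial_sum d X n \<omega>}" "\<omega> \<notin> ?T \<union> ?J"
      hence "(\<Sum>k\<in>A. min (s * X k \<omega>) b) = (\<Sum>k\<in>A. s * X k \<omega>)"
        by (intro sum.cong) (auto simp: not_less)
      also have "\<dots> = s * partial_sum d X n \<omega>"
        by (simp add: partial_sum_def A_def sum_distrib_left)
      finally show False using \<omega> by simp
    qed
    have "cap Ps ?J \<le> (\<Sum>k\<in>A. cap Ps {\<omega>\<in>space M. b < s * X k \<omega>})"
      using A by (intro cap_UN_le) auto
    also have "\<dots> \<le> (\<Sum>k\<in>A. cap Ps {\<omega>\<in>space M. N < \<bar>X0 \<omega>\<bar>})"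
    proof (intro sum_mono)
      fix k assume k: "k \<in> A"
      hence kl: "k \<in> lattice d" using A by blast
      have "cap Ps {\<omega>\<in>space M. b < s * X k \<omega>} \<le> cap Ps {\<omega>\<in>space M. b < \<bar>X k \<omega>\<bar>}"
      proof (rule cap_mono)
        have "s * x \<le> \<bar>x\<bar>" for x using abs_ge_self[of "s * x"] s by (simp add: abs_mult)
        thus "{\<omega>\<in>space M. b < s * X k \<omega>} \<subseteq> {\<omega>\<in>space M. b < \<bar>X k \<omega>\<bar>}"
          by (auto intro: less_le_trans)
        show "{\<omega>\<in>space M. b < \<bar>X k \<omega>\<bar>} \<in> sets M" using k by measurable
      qed
      also have "\<dots> \<le> cap Ps {\<omega>\<in>space M. N < \<bar>X0 \<omega>\<bar>}"
        using k kl by (intro cap_abs_tail_ident ident X(1) X0(1) b(2))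
      finally show "cap Ps {\<omega>\<in>space M. b < s * X k \<omega>} \<le> cap Ps {\<omega>\<in>space M. N < \<bar>X0 \<omega>\<bar>}" .
    qed
    also have "\<dots> = N * cap Ps {\<omega>\<in>space M. N < \<bar>X0 \<omega>\<bar>}"
      by (simp add: A N_def)
    finally have J: "cap Ps ?J \<le> N * cap Ps {\<omega>\<in>space M. N < \<bar>X0 \<omega>\<bar>}" .
    note lip = trunc_exp_lipschitz[OF l s, of b]
    have f: "0 < trunc_exp s l b x" "trunc_exp s l b x \<le> 1" for x
      using l by (auto simp: trunc_exp_def mult_nonneg_nonpos)
    have prod: "(\<lambda>\<omega>. \<Prod>k\<in>A. trunc_exp s l b (X k \<omega>)) \<in> H"
      "E (\<lambda>\<omega>. \<Prod>k\<in>A. trunc_exp s l b (X k \<omega>)) = E (\<lambda>\<omega>. trunc_exp s l b (X0 \<omega>)) ^ card A"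
      by (rule E_prod_field[OF X ident f lip A(1,2)]; assumption)+
    have prod_eq: "(\<Prod>k\<in>A. trunc_exp s l b (X k \<omega>))
        = exp (l * (\<Sum>k\<in>A. min (s * X k \<omega>) b) - l * b * N)" for \<omega>
      by (simp add: trunc_exp_def A(1) sum_distrib_left sum_subtractf right_diff_distrib A(3) N_def
          mult_ac flip: exp_sum)
    \<comment> \<open>The term \<open>l * b * N\<close> undoes the shifts by \<open>b\<close> in the
      factors of the product.\<close>
    have "cap Ps ?T \<le> exp (l * b * N - l * N * \<epsilon>) * E (\<lambda>\<omega>. \<Prod>k\<in>A. trunc_exp s l b (X k \<omega>))"
    proof (rule cap_le_E[OF prod(1) _ T_meas])
      fix \<omega> assume "\<omega> \<in> ?T"
      hence "l * (N * \<epsilon>) \<le> l * (\<Sum>k\<in>A. min (s * X k \<omega>) b)"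
        using l by (intro mult_left_mono) auto
      thus "1 \<le> exp (l * b * N - l * N * \<epsilon>) * (\<Prod>k\<in>A. trunc_exp s l b (X k \<omega>))"
        unfolding prod_eq exp_add[symmetric] by (simp add: mult_ac)
    qed (auto simp: prod_eq)
    also have "E (\<lambda>\<omega>. \<Prod>k\<in>A. trunc_exp s l b (X k \<omega>)) \<le> (exp (- (l * b)) * exp (l\<^sup>2 * D)) ^ idx_abs n"
      unfolding prod(2) A(3)
    proof (intro power_mono)
      have "E (\<lambda>\<omega>. trunc_exp s l b (X0 \<omega>)) \<le> exp (- (l * b)) * (1 + l\<^sup>2 * D)"
        unfolding l_def using b(1) by (rule D(2))
      also have "\<dots> \<le> exp (- (l * b)) * exp (l\<^sup>2 * D)"
        using exp_ge_add_one_self by (intro mult_left_mono) auto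
      finally show "E (\<lambda>\<omega>. trunc_exp s l b (X0 \<omega>)) \<le> exp (- (l * b)) * exp (l\<^sup>2 * D)" .
      show "0 \<le> E (\<lambda>\<omega>. trunc_exp s l b (X0 \<omega>))"
        using f by (intro E_nonneg H_lipschitz[OF X0(1) lip]) (auto intro: less_imp_le)
    qed
    also have "(exp (- (l * b)) * exp (l\<^sup>2 * D)) ^ idx_abs n = exp (N * (l\<^sup>2 * D - l * b))"
      by (simp add: N_def exp_of_nat_mult flip: exp_add)
    finally have "cap Ps ?T \<le> exp (l * b * N - l * N * \<epsilon>) * exp (N * (l\<^sup>2 * D - l * b))"
      by (simp add: mult_left_mono)
    also have "\<dots> = exp (D * (N * l\<^sup>2)) * exp (- (l * N * \<epsilon>))"
      by (simp add: algebra_simps flip: exp_add)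
    also have "\<dots> \<le> exp (D * (2 * \<alpha>) powr (2 * \<alpha>)) * exp (- (logp N powr \<alpha>))"
    proof (intro mult_mono)
      have "N * l\<^sup>2 \<le> b * l\<^sup>2" using b by (intro mult_right_mono) auto
      also have "\<dots> = \<theta>\<^sup>2 * (ln b powr (2 * \<alpha>) / b)"
        using b by (simp add: l_def slope_def power2_eq_square powr_add[symmetric] field_simps)
      also have "\<dots> \<le> 1 * (2 * \<alpha>) powr (2 * \<alpha>)"
        using \<theta> b ln_powr_bound2[of b "2 * \<alpha>"] \<alpha>
        by (intro mult_mono) (auto simp: power_le_one pos_divide_le_eq)
      finally have "D * (N * l\<^sup>2) \<le> D * (2 * \<alpha>) powr (2 * \<alpha>)"
        using D(1) by (intro mult_left_mono) auto
      thus "exp (D * (N * l\<^sup>2)) \<le> exp (D * (2 * \<alpha>) powr (2 * \<alpha>))" by simp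
      \<comment> \<open>The factors of \<open>c\<close> from \<open>\<theta>\<close>,
        \<open>b\<close> and \<open>\<epsilon>\<close> cancel exactly.\<close>
      have "l * N * \<epsilon> = ln b powr \<alpha>"
        using c N1 unfolding l_def slope_def \<theta>_def b_def by (simp flip: c(2))
      also have "\<dots> \<ge> logp N powr \<alpha>"
        using N1 b \<alpha> by (intro powr_mono2) (auto simp: logp_eq_ln)
      finally show "exp (- (l * N * \<epsilon>)) \<le> exp (- (logp N powr \<alpha>))" by simp
    qed auto
    finally have T: "cap Ps ?T \<le> exp (D * (2 * \<alpha>) powr (2 * \<alpha>)) * exp (- (logp N powr \<alpha>))" .
    show "cap Ps {\<omega>\<in>space M. real (idx_abs n) * \<epsilon> < s * partial_sum d X n \<omega>}
      \<le> real (idx_abs n) * cap Ps {\<omega>\<in>space M. real (idx_abs n) < \<bar>X0 \<omega>\<bar>}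
        + exp (D * (2 * \<alpha>) powr (2 * \<alpha>)) * exp (- (logp (real (idx_abs n)) powr \<alpha>))"
      using cap_Un_le[OF T_meas J_meas sub] T J unfolding N_def by linarith
  qed simp
qed

end

section \<open>Two-sided tails and summability over the lattice\<close>

theorem theorem5p1:
  fixes M :: "'a measure" and Ps :: "'a measure set" and H :: "('a \<Rightarrow> real) set"
    and E :: "('a \<Rightarrow> real) \<Rightarrow> real"
    and d :: nat and \<alpha> :: real
    and X :: "nat list \<Rightarrow> 'a \<Rightarrow> real" and X0 :: "'a \<Rightarrow> real"
  assumes space: "sublinear_space M Ps H E"
    and d: "d \<ge> 2" and alpha: "\<alpha> > 1"
    and inH: "X0 \<in> H" "\<And>k. k \<in> lattice d \<Longrightarrow> X k \<in> H"
    and indep: "sl_indep_field E d X"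
    and ident: "\<And>k. k \<in> lattice d \<Longrightarrow> sl_ident E (X k) X0"
    and mean0: "E X0 = 0" "E (\<lambda>\<omega>. - X0 \<omega>) = 0"
    and moment: "choquet_finite M Ps
       (\<lambda>\<omega>. exp ((logp \<bar>X0 \<omega>\<bar>) powr \<alpha>) * (logp \<bar>X0 \<omega>\<bar>) ^ (d - 1))"
  shows "\<forall>\<epsilon>>1. (\<lambda>n. exp ((logp (real (idx_abs n))) powr \<alpha>)
              * (logp (real (idx_abs n))) powr (\<alpha> - 1) / (real (idx_abs n))^2
              * cap Ps {\<omega>\<in>space M. \<bar>partial_sum d X n \<omega>\<bar> > real (idx_abs n) * \<epsilon>})
           summable_on lattice d"
proof (intro allI impI)
  fix \<epsilon> :: real assume \<epsilon>: "1 < \<epsilon>"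
  interpret sublinear_expectation M Ps H E by unfold_locales (rule space)
  obtain p where p: "d = Suc p" using d by (cases d) auto
  have [measurable]: "X0 \<in> borel_measurable M" by (rule measurable_H[OF inH(1)])
  define v where "v = (\<lambda>m :: nat. cap Ps {\<omega>\<in>space M. real m < \<bar>X0 \<omega>\<bar>})"
  define w where "w = (\<lambda>x. cap Ps {\<omega>\<in>space M. moment_fun \<alpha> p \<bar>X0 \<omega>\<bar> > x})"
  have w: "set_integrable lborel {0..} w"
    using moment unfolding choquet_finite_def w_def moment_fun_def p by simp
  have mono_v: "antimono v"
    unfolding v_def by (intro antimonoI cap_mono) auto
  have vw: "v m \<le> w x" if "x < moment_fun \<alpha> p (real m)" for m x
    unfolding v_def w_def
  proof (rule cap_mono)
    show "{\<omega>\<in>space M. real m < \<bar>X0 \<omega>\<bar>} \<subseteq> {\<omega>\<in>space M. x < moment_fun \<alpha> p \<bar>X0 \<omega>\<bar>}"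
      using that moment_fun_mono[of \<alpha> "real m" _ p] alpha
      by (auto intro!: less_le_trans[OF that])
    show "{\<omega>\<in>space M. x < moment_fun \<alpha> p \<bar>X0 \<omega>\<bar>} \<in> sets M"
      unfolding moment_fun_def by measurable
  qed
  obtain C1 where C1: "\<And>N. (\<Sum>n | n \<in> lattice d \<and> idx_abs n \<le> N.
      weight_fun \<alpha> (real (idx_abs n)) * v (idx_abs n)) \<le> C1"
    using sum_weight_fun_tail_bounded[OF alpha mono_v _ w _ vw] cap_nonneg
    unfolding p v_def w_def by blast
  obtain C2 where C2: "\<And>N. (\<Sum>n | n \<in> lattice d \<and> idx_abs n \<le> N. real (idx_abs n) powr (- 3 / 2)) \<le> C2"
    using sum_idx_abs_powr_bounded[of "- 3 / 2" d] by auto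
  note one_sided = cap_partial_sum_one_sided_le[OF inH(1) mean0 inH(2) indep ident alpha \<epsilon> _ w[unfolded w_def]]
  obtain K1 where K1: "0 \<le> K1" "\<And>n. n \<in> lattice d \<Longrightarrow>
      cap Ps {\<omega>\<in>space M. real (idx_abs n) * \<epsilon> < 1 * partial_sum d X n \<omega>}
      \<le> real (idx_abs n) * v (idx_abs n) + K1 * exp (- (logp (real (idx_abs n)) powr \<alpha>))"
    using one_sided[of 1] unfolding v_def by auto
  obtain K2 where K2: "0 \<le> K2" "\<And>n. n \<in> lattice d \<Longrightarrow>
      cap Ps {\<omega>\<in>space M. real (idx_abs n) * \<epsilon> < - 1 * partial_sum d X n \<omega>}
      \<le> real (idx_abs n) * v (idx_abs n) + K2 * exp (- (logp (real (idx_abs n)) powr \<alpha>))"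
    using one_sided[of "- 1"] unfolding v_def by auto
  \<comment> \<open>Writing \<open>ln N\<close> as twice the logarithm of the square root gives
    \<open>(ln N) powr (\<alpha> - 1) \<le> B * N powr (1 / 2)\<close>. Divided by
    \<open>N\<^sup>2\<close> this leaves the exponent -3/2, still below -1.\<close>
  define B where "B = (2 * (\<alpha> - 1)) powr (\<alpha> - 1)"
  define f where "f = (\<lambda>n. exp ((logp (real (idx_abs n))) powr \<alpha>)
              * (logp (real (idx_abs n))) powr (\<alpha> - 1) / (real (idx_abs n))^2
              * cap Ps {\<omega>\<in>space M. \<bar>partial_sum d X n \<omega>\<bar> > real (idx_abs n) * \<epsilon>})"
  have f_le: "f n \<le> 2 * (weight_fun \<alpha> (real (idx_abs n)) * v (idx_abs n))
      + (K1 + K2) * B * real (idx_abs n) powr (- 3 / 2)" if n: "n \<in> lattice d" for n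
  proof -
    define N where "N = real (idx_abs n)"
    have N1: "1 \<le> N" using idx_abs_ge_1[OF n] by (simp add: N_def)
    define L where "L = logp N"
    have L0: "0 \<le> L" by (simp add: L_def logp_nonneg)
    have S_meas [measurable]: "partial_sum d X n \<in> borel_measurable M"
      unfolding partial_sum_def[abs_def]
      using measurable_H[OF inH(2)] by (intro borel_measurable_sum) auto
    have "cap Ps {\<omega>\<in>space M. \<bar>partial_sum d X n \<omega>\<bar> > N * \<epsilon>}
        \<le> cap Ps {\<omega>\<in>space M. N * \<epsilon> < 1 * partial_sum d X n \<omega>}
          + cap Ps {\<omega>\<in>space M. N * \<epsilon> < - 1 * partial_sum d X n \<omega>}"
      by (rule cap_Un_le) auto
    also have "\<dots> \<le> 2 * (N * v (idx_abs n)) + (K1 + K2) * exp (- (L powr \<alpha>))"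
      using K1(2)[OF n] K2(2)[OF n] unfolding N_def L_def by (simp add: algebra_simps)
    finally have "f n \<le> exp (L powr \<alpha>) * L powr (\<alpha> - 1) / N\<^sup>2
        * (2 * (N * v (idx_abs n)) + (K1 + K2) * exp (- (L powr \<alpha>)))"
      unfolding f_def N_def[symmetric] L_def[symmetric] by (intro mult_left_mono) auto
    \<comment> \<open>The factor \<open>N\<close> from the union bound reduces the square in the
      denominator to the weight, and the exponential tail cancels
      \<open>exp (L powr \<alpha>)\<close>.\<close>
    also have "\<dots> = 2 * (weight_fun \<alpha> N * v (idx_abs n)) + (K1 + K2) * (L powr (\<alpha> - 1) / N\<^sup>2)"
      using N1 by (simp add: weight_fun_def L_def[symmetric] field_simps power2_eq_square exp_minus)
    also have "L powr (\<alpha> - 1) / N\<^sup>2 \<le> B * N powr (- 3 / 2)"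
    proof (cases "N = 1")
      case True
      thus ?thesis by (simp add: L_def logp_def B_def)
    next
      case False
      hence "1 < N" using N1 by simp
      have "L powr (\<alpha> - 1) = (2 * ln (N powr (1 / 2))) powr (\<alpha> - 1)"
        using N1 by (simp add: L_def logp_eq_ln ln_powr)
      also have "\<dots> = 2 powr (\<alpha> - 1) * ln (N powr (1 / 2)) powr (\<alpha> - 1)"
        using N1 by (subst powr_mult) (auto simp: ln_powr)
      also have "\<dots> \<le> 2 powr (\<alpha> - 1) * ((\<alpha> - 1) powr (\<alpha> - 1) * N powr (1 / 2))"
        using \<open>1 < N\<close> alpha by (intro mult_left_mono ln_powr_bound2) auto
      also have "\<dots> = B * N powr (1 / 2)"
        unfolding B_def using alpha by (subst powr_mult) auto
      finally have "L powr (\<alpha> - 1) / N\<^sup>2 \<le> B * N powr (1 / 2) / N\<^sup>2"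
        by (intro divide_right_mono) auto
      also have "\<dots> = B * N powr (- 3 / 2)"
        using N1 powr_diff[of N "1 / 2" 2] by (simp add: powr_numeral)
      finally show ?thesis .
    qed
    finally show ?thesis
      using K1(1) K2(1) by (simp add: N_def mult_left_mono mult.assoc)
  qed
  have f0: "0 \<le> f n" for n by (simp add: f_def cap_nonneg)
  show "f summable_on lattice d"
  proof (rule nonneg_bdd_above_summable_on)
    show "bdd_above (sum f ` {F. F \<subseteq> lattice d \<and> finite F})"
    proof (intro bdd_aboveI2)
      fix F assume F: "F \<in> {F. F \<subseteq> lattice d \<and> finite F}"
      \<comment> \<open>A finite set of indices lies in one hyperbolic region; inserting 0 keeps the
        maximum defined for the empty set.\<close>
      define N where "N = Max (insert 0 (idx_abs ` F))"
      let ?L = "{n \<in> lattice d. idx_abs n \<le> N}"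
      have "sum f F \<le> sum f ?L"
        using F f0 by (intro sum_mono2 finite_lattice_idx_abs_le) (auto simp: N_def)
      also have "\<dots> \<le> (\<Sum>n\<in>?L. 2 * (weight_fun \<alpha> (real (idx_abs n)) * v (idx_abs n))
          + (K1 + K2) * B * real (idx_abs n) powr (- 3 / 2))"
        by (intro sum_mono f_le) auto
      also have "\<dots> = 2 * (\<Sum>n\<in>?L. weight_fun \<alpha> (real (idx_abs n)) * v (idx_abs n))
          + (K1 + K2) * B * (\<Sum>n\<in>?L. real (idx_abs n) powr (- 3 / 2))"
        by (simp only: sum.distrib sum_distrib_left)
      also have "\<dots> \<le> 2 * C1 + (K1 + K2) * B * C2"
        using C1[of N] C2[of N] K1(1) K2(1) by (intro add_mono mult_left_mono) (auto simp: B_def)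
      finally show "sum f F \<le> 2 * C1 + (K1 + K2) * B * C2" .
    qed
  qed (rule f0)
qed

end
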